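(* Let $(K,v,\sigma)$ be a multiplicative valued difference field of characteristic zero that is spherically complete, whose difference residue field $(\mathbf{k},\bar\sigma)$ is an ACFA of characteristic zero, whose scaling exponent $\rho>0$ is transcendental over $\mathbb{Q}$, whose value group $\Gamma$ is a subgroup of $\mathbb{R}$ that is a $\mathbb{Q}(\rho)$-module, and whose valuation has a splitting $\gamma\mapsto t^\gamma$ compatible with $\sigma$. Let $f\in K_\sigma[x_1^{\pm1},\dots,x_n^{\pm1}]$ be a (nonzero) Laurent difference polynomial and $\underline{w}=(w_1,\dots,w_n)\in\Gamma^n$ such that $\mathrm{in}_{\underline{w}}(f)$ is not a monomial. Suppose $\bar\alpha=(\bar\alpha_1,\dots,\bar\alpha_n)$ is a root of $\mathrm{in}_{\underline{w}}(f)$ in $(\mathbf{k}^* )^n$. Then there exists $y=(y_1,\dots,y_n)\in(K^* )^n$ which is a root of $f$ and satisfies: - $v(y):=(v(y_1),\dots,v(y_n))=\underline{w}$; - $\overline{t^{-w_i}y_i}=\bar\alpha_i$ for all $1\le i\le n$.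
   Context: A difference field is a field together with a field automorphism $\sigma$. An ACFA is a difference field $(k,\sigma)$ such that every finite system of difference polynomial equations over $k$ having a solution in some difference field extension of $k$ has a solution in $k$. A valued difference field is a valued field $K$ with an automorphism $\sigma$ such that $\sigma(\mathcal{O}_K)=\mathcal{O}_K$ ($\mathcal{O}_K$ the valuation ring); the residue field $\mathbf{k}$ carries the induced automorphism $\bar\sigma(\bar a)=\overline{\sigma(a)}$. It is multiplicative with scaling exponent $\rho$ (a positive real) if $v(\sigma(x))=\rho\cdot v(x)$ for all $x\in K^\times$. $K$ is spherically complete if every nonempty family of balls in $K$ totally ordered by inclusion has nonempty intersection. A splitting compatible with $\sigma$ is a group homomorphism $\Gamma\to K^\times$, $\gamma\mapsto t^\gamma$, with $v(t^\gamma)=\gamma$ and $\sigma(t^\gamma)=t^{\rho\gamma}$ for all $\gamma\in\Gamma$. $K_\sigma[x_1^{\pm1},\dots,x_n^{\pm1}]$ is the Laurent polynomial ring over $K$ in the formal variables $\sigma^j(x_i)$, $j\ge0$, $1\le i\le n$. For $u(\sigma)\in(\mathbb{Z}[\sigma])^n$, $u_i(\sigma)=\sum_j a_{i,j}\sigma^j$, write $x^{u(\sigma)}=\prod_{i,j}\sigma^j(x_i)^{a_{i,j}}$ and $u(\rho)=(\sum_j a_{i,j}\rho^j)_i\in\mathbb{R}^n$. Every $f$ is a finite sum $f=\sum c_{u(\sigma)}x^{u(\sigma)}$, evaluated at $y\in(K^* )^n$ by substituting $\sigma^j(y_i)$ for $\sigma^j(x_i)$; the same notation is used over $(\mathbf{k},\bar\sigma)$.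 A monomial is a single nonzero term. $\mathrm{trop}(f)(w)=\min\{v(c_{u(\sigma)})+u(\rho)\cdot w: c_{u(\sigma)}\neq0\}$, and $$\mathrm{in}_w(f)=\sum_{u(\sigma):\ c_{u(\sigma)}\neq 0,\ v(c_{u(\sigma)})+u(\rho)\cdot w=\mathrm{trop}(f)(w)}\overline{c_{u(\sigma)}t^{-v(c_{u(\sigma)})}}\;x^{u(\bar\sigma)}\in\mathbf{k}_{\bar\sigma}[x_1^{\pm1},\dots,x_n^{\pm1}].$$ *)

theory Defs
  imports
    "HOL-Library.Poly_Mapping"
    "HOL-Computational_Algebra.Polynomial"
    "HOL-Algebra.Algebraic_Closure_Type"
begin

section \<open>Difference fields and ACFA\<close>

definition field_automorphism :: "('k::field \<Rightarrow> 'k) \<Rightarrow> bool" where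
  "field_automorphism \<sigma> \<longleftrightarrow>
     bij \<sigma> \<and> (\<forall>x y. \<sigma> (x + y) = \<sigma> x + \<sigma> y) \<and> (\<forall>x y. \<sigma> (x * y) = \<sigma> x * \<sigma> y)"

text \<open>Extensions of a difference field have to be quantified over, so they are given as
  carrier-based fields, together with the embedding of the base field.\<close>

definition difference_field_extension ::
  "('k::field \<Rightarrow> 'k) \<Rightarrow> 'l ring \<Rightarrow> ('l \<Rightarrow> 'l) \<Rightarrow> ('k \<Rightarrow> 'l) \<Rightarrow> bool" where
  "difference_field_extension \<sigma> L \<tau> h \<longleftrightarrow>
     field L \<and> \<tau> \<in> ring_iso L L \<and> h \<in> ring_hom ring_of_type_algebra L \<and>
     (\<forall>x. h (\<sigma> x) = \<tau> (h x))"

text \<open>Difference polynomials are ordinary polynomials in the variables \<open>\<sigma>^j(x_i)\<close>; this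
  variable is represented by the pair \<open>(i, j)\<close>, and a monomial by its exponents. The number of
  unknowns is not fixed: a finite system involves only finitely many of them.\<close>

type_synonym 'k difference_poly = "((nat \<times> nat) \<Rightarrow>\<^sub>0 nat) \<Rightarrow>\<^sub>0 'k"

definition difference_poly_eval ::
  "'l ring \<Rightarrow> ('l \<Rightarrow> 'l) \<Rightarrow> ('k::zero \<Rightarrow> 'l) \<Rightarrow> 'k difference_poly \<Rightarrow> (nat \<Rightarrow> 'l) \<Rightarrow> 'l" where
  "difference_poly_eval L \<tau> h p a =
     (\<Oplus>\<^bsub>L\<^esub>e\<in>Poly_Mapping.keys p. h (Poly_Mapping.lookup p e) \<otimes>\<^bsub>L\<^esub>
        (\<Otimes>\<^bsub>L\<^esub>ij\<in>Poly_Mapping.keys e. ((\<tau> ^^ snd ij) (a (fst ij))) [^]\<^bsub>L\<^esub> Poly_Mapping.lookup e ij))"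

definition system_solvable_in ::
  "'l ring \<Rightarrow> ('l \<Rightarrow> 'l) \<Rightarrow> ('k::zero \<Rightarrow> 'l) \<Rightarrow> 'k difference_poly set \<Rightarrow> bool" where
  "system_solvable_in L \<tau> h S \<longleftrightarrow>
     (\<exists>a. (\<forall>i. a i \<in> carrier L) \<and> (\<forall>p\<in>S. difference_poly_eval L \<tau> h p a = \<zero>\<^bsub>L\<^esub>))"

text \<open>A quantifier inside a definition cannot range over all types, so the extensions are taken
  with elements in one fixed type. This is no restriction: a solution in any extension
  lies in the difference subfield generated over \<open>k\<close> by countably many elements, and the elements
  of that subfield can be named by words over \<open>'k + nat\<close>. The lemma \<open>acfa_arbitrary_extension\<close>
  below proves that extensions with elements in an arbitrary type are covered.\<close>

definition acfa :: "('k::field \<Rightarrow> 'k) \<Rightarrow> bool" where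
  "acfa \<sigma> \<longleftrightarrow> field_automorphism \<sigma> \<and>
     (\<forall>S. finite S \<longrightarrow>
        (\<exists>(L :: ('k + nat) list ring) \<tau> h.
            difference_field_extension \<sigma> L \<tau> h \<and> system_solvable_in L \<tau> h S) \<longrightarrow>
        system_solvable_in ring_of_type_algebra \<sigma> id S)"

lemma difference_poly_eval_hom:
  fixes A :: "'a ring" and B :: "'b ring"
  assumes "field A" "field B" and g: "g \<in> ring_hom A B"
    and tA: "\<And>x. x \<in> carrier A \<Longrightarrow> \<tau>A x \<in> carrier A"
    and gt: "\<And>x. x \<in> carrier A \<Longrightarrow> g (\<tau>A x) = \<tau>B (g x)"
    and hA: "\<And>x. hA x \<in> carrier A" and a: "\<And>i. a i \<in> carrier A"
  shows "g (difference_poly_eval A \<tau>A hA p a) = difference_poly_eval B \<tau>B (\<lambda>x. g (hA x)) p (\<lambda>i. g (a i))"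
proof -
  interpret A: field A by fact
  interpret B: field B by fact
  interpret ring_hom_cring A B g
    by (intro ring_hom_cring.intro ring_hom_cring_axioms.intro A.is_cring B.is_cring g)
  have it: "(\<tau>A ^^ j) x \<in> carrier A \<and> g ((\<tau>A ^^ j) x) = (\<tau>B ^^ j) (g x)"
    if "x \<in> carrier A" for x j
    by (induction j) (use that tA gt in auto)
  have itc: "(\<tau>A ^^ j) (a i) \<in> carrier A" for i j using it[OF a] by blast
  have ite: "g ((\<tau>A ^^ j) (a i)) = (\<tau>B ^^ j) (g (a i))" for i j using it[OF a] by blast
  have pc: "(\<Otimes>\<^bsub>A\<^esub>ij\<in>E. ((\<tau>A ^^ snd ij) (a (fst ij))) [^]\<^bsub>A\<^esub> (m ij :: nat)) \<in> carrier A" for E m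
    by (intro A.finprod_closed) (auto intro: itc)
  have ph: "g (\<Otimes>\<^bsub>A\<^esub>ij\<in>E. ((\<tau>A ^^ snd ij) (a (fst ij))) [^]\<^bsub>A\<^esub> (m ij :: nat))
      = (\<Otimes>\<^bsub>B\<^esub>ij\<in>E. ((\<tau>B ^^ snd ij) (g (a (fst ij)))) [^]\<^bsub>B\<^esub> (m ij :: nat))" for E m
  proof -
    have c: "(\<tau>B ^^ j) (g (a i)) \<in> carrier B" for i j using itc[of j i] ite[of j i] hom_closed by metis
    have "g (\<Otimes>\<^bsub>A\<^esub>ij\<in>E. ((\<tau>A ^^ snd ij) (a (fst ij))) [^]\<^bsub>A\<^esub> (m ij :: nat))
      = (\<Otimes>\<^bsub>B\<^esub>ij\<in>E. g (((\<tau>A ^^ snd ij) (a (fst ij))) [^]\<^bsub>A\<^esub> (m ij :: nat)))"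
      by (subst hom_finprod) (auto intro: itc simp: comp_def)
    also have "\<dots> = (\<Otimes>\<^bsub>B\<^esub>ij\<in>E. ((\<tau>B ^^ snd ij) (g (a (fst ij)))) [^]\<^bsub>B\<^esub> (m ij :: nat))"
      by (intro B.finprod_cong) (auto simp: ite c itc simp_implies_def)
    finally show ?thesis .
  qed
  show ?thesis
    unfolding difference_poly_eval_def
    apply (subst hom_finsum)
     apply (use hA pc in auto)[1]
    apply (intro B.finsum_cong)
      apply (auto simp: comp_def hA pc ph[symmetric] simp_implies_def)
    done
qed

lemma acfa_arbitrary_extension:
  fixes \<sigma> :: "'k::field \<Rightarrow> 'k" and L :: "'l ring"
  assumes "acfa \<sigma>" and "finite S"
    and ext: "difference_field_extension \<sigma> L \<tau> h" and sol: "system_solvable_in L \<tau> h S"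
  shows "system_solvable_in ring_of_type_algebra \<sigma> id S"
proof -
  interpret L: field L using ext by (simp add: difference_field_extension_def)
  have h: "h \<in> ring_hom ring_of_type_algebra L" and h\<sigma>: "\<And>x. h (\<sigma> x) = \<tau> (h x)"
    and \<tau>: "\<tau> \<in> ring_hom L L" and \<tau>b: "bij_betw \<tau> (carrier L) (carrier L)"
    using ext by (auto simp: difference_field_extension_def ring_iso_def)
  have hc: "h x \<in> carrier L" for x
    using ring_hom_closed[OF h, of x] by (simp add: ring_of_type_algebra_def)
  obtain a where a: "\<And>i. a i \<in> carrier L"
    and a0: "\<And>p. p \<in> S \<Longrightarrow> difference_poly_eval L \<tau> h p a = \<zero>\<^bsub>L\<^esub>"
    using sol by (auto simp: system_solvable_in_def)
  define \<tau>i where "\<tau>i = inv_into (carrier L) \<tau>"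
  have \<tau>c: "\<tau> x \<in> carrier L" "\<tau>i x \<in> carrier L" "\<tau>i (\<tau> x) = x" "\<tau> (\<tau>i x) = x"
    if "x \<in> carrier L" for x
    using \<tau>b that unfolding \<tau>i_def
    by (auto simp: bij_betw_def inv_into_into f_inv_into_f)

  \<comment> \<open>Words act as programs of a stack machine computing in \<open>L\<close>.\<close>
  define step :: "'l list \<Rightarrow> 'k + nat \<Rightarrow> 'l list" where
    "step st c = (case c of
       Inl x \<Rightarrow> h x # st
     | Inr m \<Rightarrow>
         if m = 0 then (hd (tl st) \<oplus>\<^bsub>L\<^esub> hd st) # tl (tl st)
         else if m = 1 then (hd (tl st) \<otimes>\<^bsub>L\<^esub> hd st) # tl (tl st)
         else if m = 2 then (\<ominus>\<^bsub>L\<^esub> hd st) # tl st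
         else if m = 3 then (inv\<^bsub>L\<^esub> hd st) # tl st
         else if m = 4 then \<tau> (hd st) # tl st
         else if m = 5 then \<tau>i (hd st) # tl st
         else a (m - 6) # st)" for st c
  define names where "names w x \<longleftrightarrow> x \<in> carrier L \<and> (\<forall>st. foldl step st w = x # st)" for w x
  define F where "F = {x. \<exists>w. names w x}"
  define enc where "enc x = (SOME w. names w x)" for x
  have FL: "F \<subseteq> carrier L" by (auto simp: F_def names_def)
  have enc: "names (enc x) x" if "x \<in> F" for x
    using that unfolding F_def enc_def by (auto intro: someI)
  have names_inj: "names w x \<Longrightarrow> names w y \<Longrightarrow> x = y" for w x y
    by (auto simp: names_def)
  have inj: "inj_on enc F"
    by (rule inj_onI) (metis enc names_inj)
  have Fh: "h x \<in> F" for x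
    unfolding F_def names_def by (auto intro!: exI[of _ "[Inl x]"] simp: step_def hc)
  have Fa: "a i \<in> F" for i
    unfolding F_def names_def by (auto intro!: exI[of _ "[Inr (i + 6)]"] simp: step_def a)
  have Fun1: "names (w @ [Inr 2]) (\<ominus>\<^bsub>L\<^esub> x)" "names (w @ [Inr 4]) (\<tau> x)" "names (w @ [Inr 5]) (\<tau>i x)"
    if "names w x" for w x
    using that by (auto simp: names_def step_def \<tau>c)
  have Finv: "names (w @ [Inr 3]) (inv\<^bsub>L\<^esub> x)" if "names w x" "x \<noteq> \<zero>\<^bsub>L\<^esub>" for w x
    using that by (auto simp: names_def step_def L.field_Units)
  have Fbin: "names (w @ w' @ [Inr 0]) (x \<oplus>\<^bsub>L\<^esub> y)" "names (w @ w' @ [Inr 1]) (x \<otimes>\<^bsub>L\<^esub> y)"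
    if "names w x" "names w' y" for w w' x y
    using that by (auto simp: names_def step_def)
  have F1: "\<one>\<^bsub>L\<^esub> \<in> F"
    using Fh[of 1] ring_hom_one[OF h] by (simp add: ring_of_type_algebra_def)
  have F\<tau>: "\<tau> x \<in> F" "\<tau>i x \<in> F" if "x \<in> F" for x
    using that Fun1 unfolding F_def by blast+
  have sub: "subfield F L"
  proof (rule L.subfieldI')
    have neg: "\<ominus>\<^bsub>L\<^esub> x \<in> F" if "x \<in> F" for x
      using that Fun1(1) unfolding F_def by auto
    have add: "x \<oplus>\<^bsub>L\<^esub> y \<in> F" and mult: "x \<otimes>\<^bsub>L\<^esub> y \<in> F" if "x \<in> F" "y \<in> F" for x y
      using Fbin[OF enc[OF that(1)] enc[OF that(2)]] unfolding F_def by auto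
    show "subring F L"
      by (rule L.subringI) (fact FL F1 neg mult add)+
    show "inv\<^bsub>L\<^esub> k \<in> F" if "k \<in> F - {\<zero>\<^bsub>L\<^esub>}" for k
      using that Finv unfolding F_def by blast
  qed
  define R where "R = L\<lparr>carrier := F\<rparr>"
  interpret R: field R unfolding R_def by (rule L.subfield_iff(2)[OF sub])
  have Rc: "carrier R = F" by (simp add: R_def)
  have injR: "inj_on enc (carrier R)" using inj by (simp add: Rc)
  define L' where "L' = image_ring enc R"
  interpret L': field L' unfolding L'_def by (rule R.inj_imp_image_ring_is_field[OF injR])
  have iso: "enc \<in> ring_iso R L'" unfolding L'_def by (rule inj_imp_image_ring_iso[OF injR])
  have L'c: "carrier L' = enc ` F" by (simp add: L'_def image_ring_carrier Rc)
  define dec where "dec = inv_into F enc"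
  have dec: "dec (enc x) = x" if "x \<in> F" for x
    using inj that by (simp add: dec_def)
  have enc_hom: "enc \<in> ring_hom R L'" using iso by (simp add: ring_iso_def)
  have e_add: "enc (x \<oplus>\<^bsub>L\<^esub> y) = enc x \<oplus>\<^bsub>L'\<^esub> enc y"
    and e_mult: "enc (x \<otimes>\<^bsub>L\<^esub> y) = enc x \<otimes>\<^bsub>L'\<^esub> enc y" if "x \<in> F" "y \<in> F" for x y
    using ring_hom_add[OF enc_hom, of x y] ring_hom_mult[OF enc_hom, of x y] that
    by (simp_all add: R_def)
  have e_one: "enc \<one>\<^bsub>L\<^esub> = \<one>\<^bsub>L'\<^esub>" using ring_hom_one[OF enc_hom] by (simp add: R_def)
  have e_zero: "enc \<zero>\<^bsub>L\<^esub> = \<zero>\<^bsub>L'\<^esub>" unfolding L'_def by (simp add: image_ring_zero R_def)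
  have Fcl: "x \<oplus>\<^bsub>L\<^esub> y \<in> F" "x \<otimes>\<^bsub>L\<^esub> y \<in> F" if "x \<in> F" "y \<in> F" for x y
    using R.add.m_closed[of x y] R.m_closed[of x y] that by (simp_all add: R_def)
  have dec_hom: "dec \<in> ring_hom L' L"
    by (rule ring_hom_memI)
       (use FL Fcl F1 in \<open>auto simp: L'c dec e_add[symmetric] e_mult[symmetric] e_one[symmetric]\<close>)
  define \<tau>' where "\<tau>' w = enc (\<tau> (dec w))" for w
  define h' where "h' x = enc (h x)" for x
  have "\<tau>' \<in> ring_hom L' L'"
    by (rule ring_hom_memI)
       (use FL in \<open>auto simp: L'c \<tau>'_def dec e_add[symmetric] e_mult[symmetric] e_one[symmetric]
          Fcl F1 F\<tau> ring_hom_add[OF \<tau>] ring_hom_mult[OF \<tau>] ring_hom_one[OF \<tau>] subset_iff\<close>)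
  moreover have "bij_betw \<tau>' (carrier L') (carrier L')"
    by (rule bij_betw_byWitness[where f' = "\<lambda>w. enc (\<tau>i (dec w))"])
       (use FL in \<open>auto simp: L'c \<tau>'_def dec F\<tau> \<tau>c subset_iff\<close>)
  moreover have "h' \<in> ring_hom ring_of_type_algebra L'"
    using ring_hom_add[OF h] ring_hom_mult[OF h] ring_hom_one[OF h]
    by (intro ring_hom_memI)
       (auto simp: L'c h'_def Fh e_add[symmetric] e_mult[symmetric] e_one[symmetric] ring_of_type_algebra_def)
  ultimately have ext': "difference_field_extension \<sigma> L' \<tau>' h'"
    by (auto simp: difference_field_extension_def ring_iso_def L'.field_axioms h'_def \<tau>'_def dec Fh h\<sigma>)
  have "difference_poly_eval L' \<tau>' h' p (\<lambda>i. enc (a i)) = \<zero>\<^bsub>L'\<^esub>" if "p \<in> S" for p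
  proof -
    let ?e = "difference_poly_eval L' \<tau>' h' p (\<lambda>i. enc (a i))"
    interpret dec: ring_hom_ring L' L dec
      by (rule ring_hom_ringI2[OF L'.ring_axioms L.ring_axioms dec_hom])
    have "dec ?e = difference_poly_eval L \<tau> (\<lambda>x. dec (h' x)) p (\<lambda>i. dec (enc (a i)))"
      by (rule difference_poly_eval_hom[OF L'.field_axioms L.field_axioms dec_hom])
         (auto simp: L'c \<tau>'_def h'_def dec F\<tau> Fh Fa)
    also have "\<dots> = \<zero>\<^bsub>L\<^esub>" using a0[OF that] by (simp add: h'_def dec Fh Fa)
    finally have z: "dec ?e = \<zero>\<^bsub>L\<^esub>" .
    have "\<tau>' x \<in> carrier L'" if "x \<in> carrier L'" for x
      using that F\<tau> by (auto simp: L'c \<tau>'_def dec)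
    then have it: "(\<tau>' ^^ j) (enc (a i)) \<in> carrier L'" for i j
      by (induction j) (auto simp: L'c Fa)
    have "?e \<in> carrier L'"
      unfolding difference_poly_eval_def
      by (intro L'.finsum_closed Pi_I L'.m_closed L'.finprod_closed L'.nat_pow_closed it)
         (auto simp: L'c h'_def Fh)
    then obtain x where "x \<in> F" "?e = enc x" by (auto simp: L'c)
    then show ?thesis using z e_zero by (simp add: dec)
  qed
  then have "system_solvable_in L' \<tau>' h' S"
    unfolding system_solvable_in_def by (intro exI[of _ "\<lambda>i. enc (a i)"]) (auto simp: L'c Fa)
  then show ?thesis
    using \<open>acfa \<sigma>\<close> \<open>finite S\<close> ext' unfolding acfa_def by blast
qed


section \<open>Valued difference fields\<close>

text \<open>The value of \<open>v\<close> at \<open>0\<close>, conventionally infinite, is never used; the definitions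
  below treat \<open>0\<close> separately.\<close>

definition valuation :: "('a::field \<Rightarrow> real) \<Rightarrow> bool" where
  "valuation v \<longleftrightarrow>
     (\<forall>x y. x \<noteq> 0 \<longrightarrow> y \<noteq> 0 \<longrightarrow> v (x * y) = v x + v y) \<and>
     (\<forall>x y. x \<noteq> 0 \<longrightarrow> y \<noteq> 0 \<longrightarrow> x + y \<noteq> 0 \<longrightarrow> min (v x) (v y) \<le> v (x + y))"

definition value_group :: "('a::field \<Rightarrow> real) \<Rightarrow> real set" where
  "value_group v = v ` (- {0})"

definition valuation_ring :: "('a::field \<Rightarrow> real) \<Rightarrow> 'a set" where
  "valuation_ring v = {x. x = 0 \<or> 0 \<le> v x}"

definition valuation_ideal :: "('a::field \<Rightarrow> real) \<Rightarrow> 'a set" where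
  "valuation_ideal v = {x. x = 0 \<or> 0 < v x}"

definition closed_vball :: "('a::field \<Rightarrow> real) \<Rightarrow> 'a \<Rightarrow> real \<Rightarrow> 'a set" where
  "closed_vball v a \<gamma> = {x. x = a \<or> \<gamma> \<le> v (x - a)}"

definition open_vball :: "('a::field \<Rightarrow> real) \<Rightarrow> 'a \<Rightarrow> real \<Rightarrow> 'a set" where
  "open_vball v a \<gamma> = {x. x = a \<or> \<gamma> < v (x - a)}"

definition vballs :: "('a::field \<Rightarrow> real) \<Rightarrow> 'a set set" where
  "vballs v = {closed_vball v a \<gamma> |a \<gamma>. \<gamma> \<in> value_group v} \<union>
              {open_vball v a \<gamma> |a \<gamma>. \<gamma> \<in> value_group v}"

definition spherically_complete :: "('a::field \<Rightarrow> real) \<Rightarrow> bool" where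
  "spherically_complete v \<longleftrightarrow>
     (\<forall>\<B>. \<B> \<subseteq> vballs v \<longrightarrow> \<B> \<noteq> {} \<longrightarrow> (\<forall>B\<in>\<B>. \<forall>C\<in>\<B>. B \<subseteq> C \<or> C \<subseteq> B) \<longrightarrow> \<Inter>\<B> \<noteq> {})"

text \<open>The residue field comes as a second sort with the residue map \<open>res\<close>: the type \<open>'k\<close>
  is the quotient of the valuation ring by its maximal ideal, and \<open>res\<close> the quotient map. Outside
  the valuation ring \<open>res\<close> is arbitrary.\<close>

definition residue_map :: "('a::field \<Rightarrow> real) \<Rightarrow> ('a \<Rightarrow> 'k::field) \<Rightarrow> bool" where
  "residue_map v res \<longleftrightarrow>
     res ` valuation_ring v = UNIV \<and>
     res 1 = 1 \<and>
     (\<forall>x\<in>valuation_ring v. \<forall>y\<in>valuation_ring v.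
        res (x + y) = res x + res y \<and> res (x * y) = res x * res y) \<and>
     (\<forall>x\<in>valuation_ring v. res x = 0 \<longleftrightarrow> x \<in> valuation_ideal v)"

definition valued_difference_field :: "('a::field \<Rightarrow> real) \<Rightarrow> ('a \<Rightarrow> 'a) \<Rightarrow> bool" where
  "valued_difference_field v \<sigma> \<longleftrightarrow>
     valuation v \<and> field_automorphism \<sigma> \<and> \<sigma> ` valuation_ring v = valuation_ring v"

definition multiplicative_with_exponent :: "('a::field \<Rightarrow> real) \<Rightarrow> ('a \<Rightarrow> 'a) \<Rightarrow> real \<Rightarrow> bool" where
  "multiplicative_with_exponent v \<sigma> \<rho> \<longleftrightarrow> 0 < \<rho> \<and> (\<forall>x. x \<noteq> 0 \<longrightarrow> v (\<sigma> x) = \<rho> * v x)"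

definition induced_on_residues ::
  "('a::field \<Rightarrow> real) \<Rightarrow> ('a \<Rightarrow> 'k) \<Rightarrow> ('a \<Rightarrow> 'a) \<Rightarrow> ('k \<Rightarrow> 'k) \<Rightarrow> bool" where
  "induced_on_residues v res \<sigma> \<sigma>' \<longleftrightarrow> (\<forall>x\<in>valuation_ring v. \<sigma>' (res x) = res (\<sigma> x))"

definition compatible_splitting ::
  "('a::field \<Rightarrow> real) \<Rightarrow> ('a \<Rightarrow> 'a) \<Rightarrow> real \<Rightarrow> (real \<Rightarrow> 'a) \<Rightarrow> bool" where
  "compatible_splitting v \<sigma> \<rho> t \<longleftrightarrow>
     (\<forall>\<gamma>\<in>value_group v. \<forall>\<delta>\<in>value_group v. t (\<gamma> + \<delta>) = t \<gamma> * t \<delta>) \<and>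
     (\<forall>\<gamma>\<in>value_group v. t \<gamma> \<noteq> 0 \<and> v (t \<gamma>) = \<gamma> \<and> \<sigma> (t \<gamma>) = t (\<rho> * \<gamma>))"

text \<open>The subfield \<open>\<rat>(\<rho>)\<close> of the reals.\<close>

definition rat_adjoin :: "real \<Rightarrow> real set" where
  "rat_adjoin \<rho> = {poly (map_poly of_rat p) \<rho> / poly (map_poly of_rat q) \<rho> |(p :: rat poly) (q :: rat poly).
     poly (map_poly of_rat q) \<rho> \<noteq> 0}"


section \<open>Laurent difference polynomials\<close>

text \<open>A Laurent difference polynomial \<open>f\<close> in variables indexed by \<open>'n\<close> is a finitely supported
  family of coefficients indexed by \<open>u(\<sigma>) \<in> (\<int>[\<sigma>])^n\<close>, with \<open>\<int>[\<sigma>]\<close> rendered as \<^typ>\<open>int poly\<close>: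
  the coefficient of \<open>\<sigma>^j\<close> in \<open>u i\<close> is the exponent of the variable \<open>\<sigma>^j(x_i)\<close>.\<close>

type_synonym ('n, 'a) laurent_difference_poly = "('n \<Rightarrow> int poly) \<Rightarrow>\<^sub>0 'a"

definition monom_eval :: "('a::field \<Rightarrow> 'a) \<Rightarrow> ('n::finite \<Rightarrow> int poly) \<Rightarrow> ('n \<Rightarrow> 'a) \<Rightarrow> 'a" where
  "monom_eval \<sigma> u y =
     (\<Prod>i\<in>UNIV. \<Prod>j\<le>Polynomial.degree (u i). ((\<sigma> ^^ j) (y i)) powi (Polynomial.coeff (u i) j))"

definition laurent_eval ::
  "('a::field \<Rightarrow> 'a) \<Rightarrow> ('n::finite, 'a) laurent_difference_poly \<Rightarrow> ('n \<Rightarrow> 'a) \<Rightarrow> 'a" where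
  "laurent_eval \<sigma> f y = (\<Sum>u\<in>Poly_Mapping.keys f. Poly_Mapping.lookup f u * monom_eval \<sigma> u y)"

definition is_monomial :: "('n, 'a::zero) laurent_difference_poly \<Rightarrow> bool" where
  "is_monomial f \<longleftrightarrow> (\<exists>u c. c \<noteq> 0 \<and> f = Poly_Mapping.single u c)"

definition term_weight ::
  "('a::field \<Rightarrow> real) \<Rightarrow> real \<Rightarrow> ('n::finite \<Rightarrow> real) \<Rightarrow> ('n, 'a) laurent_difference_poly \<Rightarrow>
   ('n \<Rightarrow> int poly) \<Rightarrow> real" where
  "term_weight v \<rho> w f u = v (Poly_Mapping.lookup f u) + (\<Sum>i\<in>UNIV. poly (map_poly of_int (u i)) \<rho> * w i)"

definition trop ::
  "('a::field \<Rightarrow> real) \<Rightarrow> real \<Rightarrow> ('n::finite, 'a) laurent_difference_poly \<Rightarrow> ('n \<Rightarrow> real) \<Rightarrow> real" where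
  "trop v \<rho> f w = Min (term_weight v \<rho> w f ` Poly_Mapping.keys f)"

definition initial_form ::
  "('a::field \<Rightarrow> real) \<Rightarrow> real \<Rightarrow> ('a \<Rightarrow> 'k::field) \<Rightarrow> (real \<Rightarrow> 'a) \<Rightarrow> ('n::finite \<Rightarrow> real) \<Rightarrow>
   ('n, 'a) laurent_difference_poly \<Rightarrow> ('n, 'k) laurent_difference_poly" where
  "initial_form v \<rho> res t w f =
     (\<Sum>u\<in>{u \<in> Poly_Mapping.keys f. term_weight v \<rho> w f u = trop v \<rho> f w}.
        Poly_Mapping.single u (res (Poly_Mapping.lookup f u * t (- v (Poly_Mapping.lookup f u)))))"

end

(* Substituting y_i = t^(w_i) z_i and dividing by t^trop turns f into a Laurent difference polynomial
   over the valuation ring whose reduction is in_w(f), so it suffices to lift a root of a reduction.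
   Putting z_i = a_i + sigma^(k_i) s, with a_i a lift of alpha_i and widely spaced k_i, leaves one
   unknown s, and the difference polynomial p(s) so obtained has p(0) in the maximal ideal and some
   other coefficient a unit. A small root of p is found by a transfinite Newton iteration: around an
   approximation a with p(a) nonzero there is a critical radius gamma for which p(a + t^gamma x) / p(a)
   is integral with nonconstant reduction; a root of that reduction in the residue field improves the
   approximation and increases gamma, and spherical completeness supplies the limits.

   The iteration needs that over an ACFA every nonconstant difference polynomial in one unknown has a
   root. A root in some extension is constructed in the algebraic closure of k(X_0, X_1, ...), with an
   automorphism obtained by extending an embedding of k[X_0, X_1, ...]. *)

theory Submission
  imports Defs
begin

section \<open>Ring homomorphisms and evaluation of polynomials\<close>

text \<open>A root of in_w(f) may be singular, with all partial derivatives zero, so the lifting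
  cannot single out a linear part as in Hensel's lemma. Each step solves the whole reduced equation
  instead; this is why roots of arbitrary nonconstant difference polynomials over k are needed.
  Passing to one unknown must not destroy the equation: with z_i = a_i + s for every i, x_1 - x_2
  would become the constant a_1 - a_2. Widely spaced k_i give each z_i its own block of iterates of
  s. A critical radius solves v(p(a)) = v(A_e) + e(\<rho>) * gamma, with A_e a Taylor coefficient of
  p at a. It lies in the value group because that group is a module over Q(\<rho>). Over k the
  obstacle is to get an automorphism. With m the order of the equation and y a root of it in the
  place of X_m, the full shift X_0, ..., X_(m-1) to X_1, ..., y is not injective if y is already
  algebraic over X_1, ..., X_(m-1). The shift must start at a variable on which y really depends,
  and the earlier variables must then be shown to be irrelevant for the equation. Dependence is
  tested by membership in algebraically closed subfields, without transcendence bases.\<close>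

locale cring_map =
  fixes h :: "'a::comm_ring_1 \<Rightarrow> 'b::comm_ring_1"
  assumes hom_one [simp]: "h 1 = 1"
    and hom_add [simp]: "h (x + y) = h x + h y"
    and hom_mult [simp]: "h (x * y) = h x * h y"
begin

lemma hom_zero [simp]: "h 0 = 0"
  using hom_add[of 0 0] by simp

lemma hom_minus [simp]: "h (- x) = - h x"
  using hom_add[of x "- x"] by (simp add: add_eq_0_iff)

lemma hom_diff [simp]: "h (x - y) = h x - h y"
  using hom_add[of x "- y"] by simp

lemma hom_power [simp]: "h (x ^ n) = h x ^ n"
  by (induction n) auto

lemma hom_sum: "h (sum f A) = (\<Sum>x\<in>A. h (f x))"
  by (induction A rule: infinite_finite_induct) auto

lemma hom_prod: "h (prod f A) = (\<Prod>x\<in>A. h (f x))"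
  by (induction A rule: infinite_finite_induct) auto

lemma hom_poly: "h (poly p x) = poly (map_poly h p) (h x)"
  by (induction p) (auto simp: map_poly_pCons)

end

lemma cring_map_comp: "cring_map g \<Longrightarrow> cring_map h \<Longrightarrow> cring_map (\<lambda>x. g (h x))"
  by (simp add: cring_map_def)

lemma cring_map_id: "cring_map (\<lambda>x. x)"
  by (simp add: cring_map_def)

lemma cring_map_funpow:
  fixes \<tau> :: "'a::comm_ring_1 \<Rightarrow> 'a"
  shows "cring_map \<tau> \<Longrightarrow> cring_map (\<tau> ^^ n)"
  by (induction n) (auto simp: cring_map_def)

lemma cring_map_field_inj:
  fixes h :: "'a::field \<Rightarrow> 'b::field"
  assumes "cring_map h" shows "inj h"
proof (rule injI)
  interpret cring_map h by fact
  fix x y assume "h x = h y"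
  then have z: "h (x - y) = 0" by simp
  show "x = y"
  proof (rule ccontr)
    assume "x \<noteq> y"
    then have "h ((x - y) * inverse (x - y)) = 1" by simp
    then show False using z hom_mult by simp
  qed
qed

lemma field_automorphism_cring_map:
  assumes "field_automorphism \<sigma>" shows "cring_map \<sigma>"
proof -
  have a: "\<sigma> (x + y) = \<sigma> x + \<sigma> y" and m: "\<sigma> (x * y) = \<sigma> x * \<sigma> y" and s: "surj \<sigma>" for x y
    using assms by (auto simp: field_automorphism_def bij_def)
  obtain u where "\<sigma> u = 1" using s by (metis surjD)
  then have "\<sigma> 1 = 1" using m[of u 1] by simp
  then show ?thesis using a m by unfold_locales auto
qed

type_synonym ('v, 'a) mpol = "('v \<Rightarrow>\<^sub>0 nat) \<Rightarrow>\<^sub>0 'a"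

definition mono_eval :: "('v \<Rightarrow> 'b::comm_ring_1) \<Rightarrow> ('v \<Rightarrow>\<^sub>0 nat) \<Rightarrow> 'b" where
  "mono_eval x e = (\<Prod>v\<in>Poly_Mapping.keys e. x v ^ Poly_Mapping.lookup e v)"

text \<open>The coefficient map \<open>h\<close> lets one notion serve for evaluation (identity),
  for substitution of polynomials (\<open>mp_const\<close>) and for evaluation twisted by
  \<sigma>.\<close>

definition mp_eval :: "('a::zero \<Rightarrow> 'b) \<Rightarrow> ('v \<Rightarrow> 'b::comm_ring_1) \<Rightarrow> ('v, 'a) mpol \<Rightarrow> 'b" where
  "mp_eval h x p = (\<Sum>e\<in>Poly_Mapping.keys p. h (Poly_Mapping.lookup p e) * mono_eval x e)"

definition mp_const :: "'a::comm_ring_1 \<Rightarrow> ('v, 'a) mpol" where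
  "mp_const c = Poly_Mapping.single 0 c"

definition mp_var :: "'v \<Rightarrow> ('v, 'a::comm_ring_1) mpol" where
  "mp_var v = Poly_Mapping.single (Poly_Mapping.single v 1) 1"

definition mp_vars :: "('v, 'a::zero) mpol \<Rightarrow> 'v set" where
  "mp_vars p = (\<Union>e\<in>Poly_Mapping.keys p. Poly_Mapping.keys e)"

lemma finite_mp_vars: "finite (mp_vars p)"
  by (simp add: mp_vars_def)

lemma mono_eval_superset:
  assumes "finite A" "Poly_Mapping.keys e \<subseteq> A"
  shows "mono_eval x e = (\<Prod>v\<in>A. x v ^ Poly_Mapping.lookup e v)"
  unfolding mono_eval_def
  by (rule prod.mono_neutral_left) (use assms in \<open>auto simp: in_keys_iff\<close>)

lemma mono_eval_zero [simp]: "mono_eval x 0 = 1"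
  by (simp add: mono_eval_def)

lemma mono_eval_add: "mono_eval x (d + e) = mono_eval x d * mono_eval x e"
proof -
  let ?A = "Poly_Mapping.keys d \<union> Poly_Mapping.keys e"
  have "mono_eval x (d + e) = (\<Prod>v\<in>?A. x v ^ Poly_Mapping.lookup (d + e) v)"
    by (rule mono_eval_superset) (auto simp: keys_add)
  then show ?thesis
    by (simp add: mono_eval_superset[of ?A d] mono_eval_superset[of ?A e]
        prod.distrib lookup_add power_add)
qed

lemma mono_eval_single [simp]: "mono_eval x (Poly_Mapping.single v n) = x v ^ n"
  by (cases "n = 0") (auto simp: mono_eval_def)

lemma mp_eval_superset:
  assumes "finite A" "Poly_Mapping.keys p \<subseteq> A" "h 0 = 0"
  shows "mp_eval h x p = (\<Sum>e\<in>A. h (Poly_Mapping.lookup p e) * mono_eval x e)"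
  unfolding mp_eval_def
  by (rule sum.mono_neutral_left) (use assms in \<open>auto simp: in_keys_iff\<close>)

lemma mp_eval_single: "h 0 = 0 \<Longrightarrow> mp_eval h x (Poly_Mapping.single e c) = h c * mono_eval x e"
  by (cases "c = 0") (auto simp: mp_eval_def)

lemma mpol_induct [case_names add single]:
  fixes p :: "('v, 'a::comm_ring_1) mpol"
  assumes add: "\<And>p q. P p \<Longrightarrow> P q \<Longrightarrow> P (p + q)"
    and single: "\<And>e c. P (Poly_Mapping.single e c)"
  shows "P p"
proof -
  have "P (\<Sum>e\<in>A. Poly_Mapping.single e (Poly_Mapping.lookup p e))" for A
    by (induction A rule: infinite_finite_induct)
       (use add single single[of 0 0] in auto)
  moreover have "(\<Sum>e\<in>Poly_Mapping.keys p. Poly_Mapping.single e (Poly_Mapping.lookup p e)) = p"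
    by (rule poly_mapping_eqI) (auto simp: lookup_sum lookup_single when_def in_keys_iff)
  ultimately show ?thesis by metis
qed

context cring_map
begin

lemma mp_eval_add: "mp_eval h x (p + q) = mp_eval h x p + mp_eval h x q"
proof -
  let ?A = "Poly_Mapping.keys p \<union> Poly_Mapping.keys q"
  have "mp_eval h x (p + q) = (\<Sum>e\<in>?A. h (Poly_Mapping.lookup (p + q) e) * mono_eval x e)"
    by (rule mp_eval_superset) (auto simp: keys_add)
  then show ?thesis
    by (simp add: mp_eval_superset[of ?A p] mp_eval_superset[of ?A q]
        sum.distrib lookup_add algebra_simps)
qed

lemma mp_eval_mult: "mp_eval h x (p * q) = mp_eval h x p * mp_eval h x q"
proof (induction p rule: mpol_induct)
  case (single e c)
  show ?case
  proof (induction q rule: mpol_induct)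
    case (single d b)
    show ?case by (simp add: mult_single mp_eval_single mono_eval_add algebra_simps)
  qed (simp add: mp_eval_add algebra_simps)
qed (simp add: mp_eval_add algebra_simps)

lemma mp_eval_hom: "cring_map (mp_eval h x)"
proof
  have "mp_eval h x (Poly_Mapping.single 0 1) = 1" by (subst mp_eval_single) auto
  then show "mp_eval h x 1 = 1" by simp
qed (fact mp_eval_add mp_eval_mult)+

lemma mp_eval_const [simp]: "mp_eval h x (mp_const c) = h c"
  by (simp add: mp_const_def mp_eval_single)

lemma mp_eval_var [simp]: "mp_eval h x (mp_var v) = x v"
  by (simp add: mp_var_def mp_eval_single)

lemma hom_mono_eval: "h (mono_eval x e) = mono_eval (\<lambda>v. h (x v)) e"
  by (simp add: mono_eval_def hom_prod)

lemma hom_mp_eval: "h (mp_eval g x p) = mp_eval (\<lambda>c. h (g c)) (\<lambda>v. h (x v)) p"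
  by (simp add: mp_eval_def hom_sum hom_mono_eval)

end

lemma cring_map_mp_const: "cring_map mp_const"
  by unfold_locales (simp_all add: mp_const_def single_add mult_single)

lemma mp_eval_self: "mp_eval mp_const mp_var p = (p :: ('v, 'a::comm_ring_1) mpol)"
proof (induction p rule: mpol_induct)
  case (add p q)
  then show ?case by (simp add: cring_map.mp_eval_add[OF cring_map_mp_const])
next
  case (single e c)
  interpret C: cring_map "mp_const :: 'a \<Rightarrow> ('v, 'a) mpol" by (rule cring_map_mp_const)
  have pw: "(mp_var v :: ('v, 'a) mpol) ^ n = Poly_Mapping.single (Poly_Mapping.single v n) 1" for v n
  proof (induction n)
    case (Suc n)
    then show ?case by (simp add: mp_var_def mult_single flip: single_add)
  qed simp
  have "finite A \<Longrightarrow> (\<Prod>v\<in>A. (mp_var v :: ('v, 'a) mpol) ^ n v)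
      = Poly_Mapping.single (\<Sum>v\<in>A. Poly_Mapping.single v (n v)) 1" for A n
    by (induction A rule: finite_induct) (auto simp: pw mult_single)
  moreover have "(\<Sum>v\<in>Poly_Mapping.keys e. Poly_Mapping.single v (Poly_Mapping.lookup e v)) = e"
    by (rule poly_mapping_eqI) (auto simp: lookup_sum lookup_single when_def in_keys_iff)
  ultimately have "mono_eval mp_var e = (Poly_Mapping.single e 1 :: ('v, 'a) mpol)"
    by (simp add: mono_eval_def)
  then show ?case by (simp add: mp_eval_single mp_const_def mult_single)
qed

lemma mp_eval_cong:
  assumes "\<And>v. v \<in> mp_vars p \<Longrightarrow> x v = y v"
  shows "mp_eval h x p = mp_eval h y p"
  unfolding mp_eval_def mono_eval_def
  by (intro sum.cong prod.cong refl arg_cong2[where f = "(*)"] arg_cong2[where f = "(^)"] assms)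
     (auto simp: mp_vars_def)

text \<open>A relation compatible with sums and products passes through evaluation. With a relation
  that ignores its second argument this gives closure of a subset; with \<open>reduces\<close> it
  gives compatibility of substitution with residues.\<close>

lemma mp_eval_rel:
  fixes p :: "('v, 'a::zero) mpol" and q :: "('v, 'b::zero) mpol"
    and h :: "'a \<Rightarrow> 'c::comm_ring_1" and h' :: "'b \<Rightarrow> 'd::comm_ring_1"
  assumes R0: "R 0 0" and R1: "R 1 1"
    and Radd: "\<And>a b c d. R a b \<Longrightarrow> R c d \<Longrightarrow> R (a + c) (b + d)"
    and Rmult: "\<And>a b c d. R a b \<Longrightarrow> R c d \<Longrightarrow> R (a * c) (b * d)"
    and "h 0 = 0" "h' 0 = 0"
    and c: "\<And>e. R (h (Poly_Mapping.lookup p e)) (h' (Poly_Mapping.lookup q e))"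
    and x: "\<And>v. v \<in> mp_vars p \<union> mp_vars q \<Longrightarrow> R (x v) (y v)"
  shows "R (mp_eval h x p) (mp_eval h' y q)"
proof -
  let ?A = "Poly_Mapping.keys p \<union> Poly_Mapping.keys q"
  have pow: "R a b \<Longrightarrow> R (a ^ n) (b ^ n)" for a b n
    by (induction n) (auto intro: R1 Rmult)
  have prod: "R (prod f A) (prod g A)" if "\<And>a. a \<in> A \<Longrightarrow> R (f a) (g a)" for f g and A :: "'v set"
    using that by (induction A rule: infinite_finite_induct) (auto intro: R1 Rmult)
  have sum: "R (sum f A) (sum g A)" if "\<And>a. a \<in> A \<Longrightarrow> R (f a) (g a)" for f g and A :: "('v \<Rightarrow>\<^sub>0 nat) set"
    using that by (induction A rule: infinite_finite_induct) (auto intro: R0 Radd)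
  have "R (\<Sum>e\<in>?A. h (Poly_Mapping.lookup p e) * mono_eval x e)
          (\<Sum>e\<in>?A. h' (Poly_Mapping.lookup q e) * mono_eval y e)"
    by (intro sum Rmult c, unfold mono_eval_def, intro prod pow x) (auto simp: mp_vars_def)
  moreover have "mp_eval h x p = (\<Sum>e\<in>?A. h (Poly_Mapping.lookup p e) * mono_eval x e)"
    by (rule mp_eval_superset) (use assms in auto)
  moreover have "mp_eval h' y q = (\<Sum>e\<in>?A. h' (Poly_Mapping.lookup q e) * mono_eval y e)"
    by (rule mp_eval_superset) (use assms in auto)
  ultimately show ?thesis by simp
qed

section \<open>Extending embeddings to algebraic extensions\<close>

text \<open>A partial embedding is represented by its graph.\<close>

definition partial_embedding :: "('e::field \<times> 'f::field) set \<Rightarrow> bool" where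
  "partial_embedding G \<longleftrightarrow>
     (1, 1) \<in> G \<and>
     (\<forall>a b c d. (a, b) \<in> G \<longrightarrow> (c, d) \<in> G \<longrightarrow>
        (a + c, b + d) \<in> G \<and> (a * c, b * d) \<in> G \<and> (- a, - b) \<in> G) \<and>
     (\<forall>a b. (a, b) \<in> G \<longrightarrow> (a = 0 \<longleftrightarrow> b = 0))"

definition graph_poly :: "('e::field \<times> 'f::field) set \<Rightarrow> 'e poly \<Rightarrow> 'f poly \<Rightarrow> bool" where
  "graph_poly G p q \<longleftrightarrow> (\<forall>n. (coeff p n, coeff q n) \<in> G)"

context
  fixes G :: "('e::field \<times> 'f::field) set"
  assumes G: "partial_embedding G"
begin

lemma partial_embedding_closed:
  "(1, 1) \<in> G"
  "(a, b) \<in> G \<Longrightarrow> (c, d) \<in> G \<Longrightarrow> (a + c, b + d) \<in> G"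
  "(a, b) \<in> G \<Longrightarrow> (c, d) \<in> G \<Longrightarrow> (a * c, b * d) \<in> G"
  "(a, b) \<in> G \<Longrightarrow> (- a, - b) \<in> G"
  "(a, b) \<in> G \<Longrightarrow> a = 0 \<longleftrightarrow> b = 0"
  using G unfolding partial_embedding_def by blast+

lemma partial_embedding_zero: "(0, 0) \<in> G"
  using partial_embedding_closed(2)[OF partial_embedding_closed(1)
      partial_embedding_closed(4)[OF partial_embedding_closed(1)]] by simp

lemma partial_embedding_sum:
  "(\<And>x. x \<in> A \<Longrightarrow> (f x, g x) \<in> G) \<Longrightarrow> (sum f A, sum g A) \<in> G"
  by (induction A rule: infinite_finite_induct)
     (auto intro: partial_embedding_zero partial_embedding_closed)

lemma partial_embedding_power: "(a, b) \<in> G \<Longrightarrow> (a ^ n, b ^ n) \<in> G"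
  by (induction n) (auto intro: partial_embedding_closed)

lemma graph_poly_closed:
  "graph_poly G p p' \<Longrightarrow> graph_poly G q q' \<Longrightarrow> graph_poly G (p + q) (p' + q')"
  "graph_poly G p p' \<Longrightarrow> graph_poly G q q' \<Longrightarrow> graph_poly G (p * q) (p' * q')"
  "graph_poly G p p' \<Longrightarrow> graph_poly G (- p) (- p')"
  by (auto simp: graph_poly_def coeff_mult
      intro!: partial_embedding_closed partial_embedding_sum)

lemma graph_poly_diff:
  "graph_poly G p p' \<Longrightarrow> graph_poly G q q' \<Longrightarrow> graph_poly G (p - q) (p' - q')"
  using graph_poly_closed(1)[of p p' "- q" "- q'"] graph_poly_closed(3) by simp

lemma graph_poly_monom: "(a, b) \<in> G \<Longrightarrow> graph_poly G (monom a n) (monom b n)"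
  by (auto simp: graph_poly_def partial_embedding_zero)

lemma graph_poly_zero_iff: "graph_poly G p q \<Longrightarrow> p = 0 \<longleftrightarrow> q = 0"
  unfolding graph_poly_def poly_eq_iff by (metis coeff_0 partial_embedding_closed(5))

lemma graph_poly_degree:
  assumes "graph_poly G p q" shows "degree p = degree q"
proof (rule antisym)
  have z: "coeff p n = 0 \<longleftrightarrow> coeff q n = 0" for n
    using assms partial_embedding_closed(5) by (auto simp: graph_poly_def)
  show "degree p \<le> degree q" by (rule degree_le) (auto simp: z coeff_eq_0)
  show "degree q \<le> degree p" by (rule degree_le) (auto simp flip: z simp: coeff_eq_0)
qed

lemma graph_poly_eval:
  assumes "graph_poly G p q" "(a, b) \<in> G" shows "(poly p a, poly q b) \<in> G"
proof -
  have "(\<Sum>i\<le>degree p. coeff p i * a ^ i, \<Sum>i\<le>degree q. coeff q i * b ^ i) \<in> G"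
    unfolding graph_poly_degree[OF assms(1)]
    by (intro partial_embedding_sum partial_embedding_closed partial_embedding_power assms)
       (use assms in \<open>auto simp: graph_poly_def\<close>)
  then show ?thesis by (simp add: poly_altdef)
qed

text \<open>Applied to differences of polynomials, \<open>compat\<close> says that p(e) \<mapsto>
  q(f) is well defined and injective, so it embeds the ring generated by \<open>e\<close>. The same
  criterion serves to adjoin inverses and algebraic elements.\<close>

lemma partial_embedding_adjoin:
  assumes compat: "\<And>p q. graph_poly G p q \<Longrightarrow> poly p e = 0 \<longleftrightarrow> poly q f = 0"
  shows "\<exists>G'. partial_embedding G' \<and> G \<subseteq> G' \<and> (e, f) \<in> G'"
proof (intro exI conjI)
  let ?G = "{(poly p e, poly q f) |p q. graph_poly G p q}"
  have c: "graph_poly G [:a:] [:b:]" if "(a, b) \<in> G" for a b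
    using graph_poly_monom[OF that, of 0] by (simp add: monom_0)
  show "G \<subseteq> ?G"
  proof
    fix z assume "z \<in> G"
    then obtain a b where z: "z = (a, b)" "(a, b) \<in> G" by (cases z) auto
    show "z \<in> ?G"
      using c[OF z(2)] by (auto simp: z(1) intro!: exI[of _ "[:a:]"] exI[of _ "[:b:]"])
  qed
  show "(e, f) \<in> ?G"
    using graph_poly_monom[OF partial_embedding_closed(1), of 1]
    by (force simp: poly_monom)
  show "partial_embedding ?G"
    unfolding partial_embedding_def
  proof (intro conjI allI impI)
    show "(1, 1) \<in> ?G" using \<open>G \<subseteq> ?G\<close> partial_embedding_closed(1) by blast
  next
    fix a b c d assume "(a, b) \<in> ?G" "(c, d) \<in> ?G"
    then obtain p p' q q' where *: "graph_poly G p p'" "graph_poly G q q'"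
      and [simp]: "a = poly p e" "b = poly p' f" "c = poly q e" "d = poly q' f" by auto
    show "(a + c, b + d) \<in> ?G" using graph_poly_closed(1)[OF *] by force
    show "(a * c, b * d) \<in> ?G" using graph_poly_closed(2)[OF *] by force
    show "(- a, - b) \<in> ?G" using graph_poly_closed(3)[OF *(1)] by force
  next
    fix a b assume "(a, b) \<in> ?G"
    then show "a = 0 \<longleftrightarrow> b = 0" using compat by auto
  qed
qed

end

text \<open>Partial embeddings are only closed under ring operations; inverses come from maximality.
  Reversing the coefficients turns a condition at the inverse of \<open>a\<close> into one at
  \<open>a\<close>, where it transfers to \<open>b\<close>.\<close>

lemma maximal_partial_embedding_field:
  assumes G: "partial_embedding G"
    and max: "\<And>G'. partial_embedding G' \<Longrightarrow> G \<subseteq> G' \<Longrightarrow> G' = G"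
    and ab: "(a, b) \<in> G" "a \<noteq> 0"
  shows "(inverse a, inverse b) \<in> G"
proof -
  have b: "b \<noteq> 0" using partial_embedding_closed(5)[OF G ab(1)] ab(2) by simp
  have "poly p (inverse a) = 0 \<longleftrightarrow> poly q (inverse b) = 0" if pq: "graph_poly G p q" for p q
  proof -
    have "graph_poly G (reflect_poly p) (reflect_poly q)"
      using pq partial_embedding_zero[OF G] graph_poly_degree[OF G pq]
      by (auto simp: graph_poly_def coeff_reflect_poly)
    then have "poly (reflect_poly p) a = 0 \<longleftrightarrow> poly (reflect_poly q) b = 0"
      using graph_poly_eval[OF G] ab(1) partial_embedding_closed(5)[OF G] by metis
    then show ?thesis using ab(2) b by (simp add: poly_reflect_poly_nz)
  qed
  from partial_embedding_adjoin[OF G this] show ?thesis using max by metis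
qed

text \<open>Polynomial division is carried out on both sides of the graph at once, so that quotients
  and remainders correspond and keep their coefficients in \<open>G\<close>.\<close>

lemma maximal_partial_embedding_division:
  assumes G: "partial_embedding G"
    and inv: "\<And>a b. (a, b) \<in> G \<Longrightarrow> a \<noteq> 0 \<Longrightarrow> (inverse a, inverse b) \<in> G"
    and p: "graph_poly G p p'" "p \<noteq> 0" and q: "graph_poly G q q'"
  shows "\<exists>d d' r r'. graph_poly G d d' \<and> graph_poly G r r' \<and> q = d * p + r \<and> q' = d' * p' + r' \<and>
           (r = 0 \<or> degree r < degree p)"
  using q
\<comment> \<open>The measure is 0 for the zero polynomial and degree plus one otherwise, so that
  cancelling a nonzero constant also counts as a descent.\<close>
proof (induction "if q = 0 then 0 else Suc (degree q)" arbitrary: q q' rule: less_induct)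
  case less
  note z = graph_poly_zero_iff[OF G] and dg = graph_poly_degree[OF G]
  have g0: "graph_poly G 0 0" by (simp add: graph_poly_def partial_embedding_zero[OF G])
  show ?case
  proof (cases "q = 0 \<or> degree q < degree p")
    case True
    then show ?thesis
      using less.prems g0 by (intro exI[of _ 0] exI[of _ q] exI[of _ q']) auto
  next
    case False
    define n where "n = degree q - degree p"
    define c where "c = lead_coeff q * inverse (lead_coeff p)"
    define c' where "c' = lead_coeff q' * inverse (lead_coeff p')"
    have lc: "(lead_coeff q, lead_coeff q') \<in> G" "(lead_coeff p, lead_coeff p') \<in> G"
      using less.prems p(1) dg[OF p(1)] dg[OF less.prems] by (auto simp: graph_poly_def)
    have cc: "(c, c') \<in> G"
      unfolding c_def c'_def
      by (intro partial_embedding_closed[OF G] inv lc) (use p(2) in simp)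
    have c0: "c \<noteq> 0" using False p(2) by (simp add: c_def)
    let ?m = "monom c n" and ?m' = "monom c' n"
    have m: "graph_poly G ?m ?m'" by (rule graph_poly_monom[OF G cc])
    have mp: "graph_poly G (?m * p) (?m' * p')" by (rule graph_poly_closed(2)[OF G m p(1)])
    have q1: "graph_poly G (q - ?m * p) (q' - ?m' * p')"
      by (rule graph_poly_diff[OF G less.prems mp])
    have deg: "degree (?m * p) = degree q"
      using False p(2) c0 by (subst degree_mult_eq) (auto simp: degree_monom_eq n_def)
    have "lead_coeff (?m * p) = lead_coeff q"
      using p(2) c0 by (subst lead_coeff_mult) (simp add: degree_monom_eq c_def)
    then have "q - ?m * p = 0 \<or> degree (q - ?m * p) < degree q"
      using degree_diff_le[of q "degree q" "?m * p"] deg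
        leading_coeff_0_iff[of "q - ?m * p"] coeff_diff[of q "?m * p" "degree q"]
      by (auto simp: le_less)
    then have "(if q - ?m * p = 0 then 0 else Suc (degree (q - ?m * p)))
        < (if q = 0 then 0 else Suc (degree q))"
      using False by auto
    from less.hyps[OF this q1] obtain d d' r r' where
      *: "graph_poly G d d'" "graph_poly G r r'" "q - ?m * p = d * p + r"
         "q' - ?m' * p' = d' * p' + r'" "r = 0 \<or> degree r < degree p" by blast
    have "q = (d + ?m) * p + r" "q' = (d' + ?m') * p' + r'"
      using *(3,4) by (simp_all add: algebra_simps diff_eq_eq)
    then show ?thesis using * graph_poly_closed(1)[OF G *(1) m] by blast
  qed
qed

text \<open>Take a maximal partial embedding by Zorn's lemma. For any \<open>e\<close>, the image of
  its minimal polynomial has a root \<open>f\<close> because the target is algebraically closed;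
  \<open>e\<close> and \<open>f\<close> satisfy corresponding equations, so maximality puts
  \<open>(e, f)\<close> into the graph.\<close>

lemma embedding_extension:
  fixes i :: "'r::idom \<Rightarrow> 'e::field" and s :: "'r \<Rightarrow> 'f::alg_closed_field"
  assumes i: "cring_map i" "inj i" and s: "cring_map s" "inj s"
    and alg: "\<And>e. \<exists>q. q \<noteq> 0 \<and> poly (map_poly i q) e = 0"
  shows "\<exists>\<tau>. cring_map \<tau> \<and> (\<forall>r. \<tau> (i r) = s r)"
proof -
  interpret i: cring_map i by fact
  interpret s: cring_map s by fact
  define \<G> where "\<G> = {G. partial_embedding G \<and> range (\<lambda>r. (i r, s r)) \<subseteq> G}"
  have i0: "i r = 0 \<longleftrightarrow> r = 0" for r using i(2) injD i.hom_zero by metis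
  have s0: "s r = 0 \<longleftrightarrow> r = 0" for r using s(2) injD s.hom_zero by metis
  have "partial_embedding (range (\<lambda>r. (i r, s r)))"
    unfolding partial_embedding_def
  proof (intro conjI allI impI)
    show "(1, 1) \<in> range (\<lambda>r. (i r, s r))" by (intro image_eqI[of _ _ 1]) auto
  next
    fix a b c d assume "(a, b) \<in> range (\<lambda>r. (i r, s r))" "(c, d) \<in> range (\<lambda>r. (i r, s r))"
    then obtain x y where [simp]: "a = i x" "b = s x" "c = i y" "d = s y" by auto
    show "(a + c, b + d) \<in> range (\<lambda>r. (i r, s r))" by (intro image_eqI[of _ _ "x + y"]) auto
    show "(a * c, b * d) \<in> range (\<lambda>r. (i r, s r))" by (intro image_eqI[of _ _ "x * y"]) auto
    show "(- a, - b) \<in> range (\<lambda>r. (i r, s r))" by (intro image_eqI[of _ _ "- x"]) auto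
  qed (use i0 s0 in auto)
  then have "\<G> \<noteq> {}" by (auto simp: \<G>_def)
  moreover have "\<Union>C \<in> \<G>" if C: "C \<noteq> {}" "subset.chain \<G> C" for C
  proof -
    have C': "partial_embedding H" "range (\<lambda>r. (i r, s r)) \<subseteq> H" if "H \<in> C" for H
      using C(2) that by (auto simp: subset.chain_def \<G>_def)
    have two: "\<exists>H\<in>C. x \<in> H \<and> y \<in> H" if "x \<in> \<Union>C" "y \<in> \<Union>C" for x y
      using that C(2) unfolding subset_chain_def by blast
    have "partial_embedding (\<Union>C)"
      unfolding partial_embedding_def
    proof (intro conjI allI impI)
      show "(1, 1) \<in> \<Union>C" using C(1) C'(1) partial_embedding_closed(1) by blast
    next
      fix a b c d assume "(a, b) \<in> \<Union>C" "(c, d) \<in> \<Union>C"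
      then obtain H where H: "H \<in> C" "(a, b) \<in> H" "(c, d) \<in> H" using two by blast
      note cl = partial_embedding_closed[OF C'(1)[OF H(1)]]
      show "(a + c, b + d) \<in> \<Union>C" "(a * c, b * d) \<in> \<Union>C" "(- a, - b) \<in> \<Union>C"
        using H cl by blast+
    next
      fix a b assume "(a, b) \<in> \<Union>C"
      then show "a = 0 \<longleftrightarrow> b = 0" using C'(1) partial_embedding_closed(5) by blast
    qed
    then show ?thesis using C' C(1) by (auto simp: \<G>_def)
  qed
  ultimately have "\<exists>M\<in>\<G>. \<forall>H\<in>\<G>. M \<subseteq> H \<longrightarrow> H = M" by (rule subset_Zorn_nonempty)
  then obtain G where G: "partial_embedding G" and ran: "range (\<lambda>r. (i r, s r)) \<subseteq> G"
    and max': "\<And>H. H \<in> \<G> \<Longrightarrow> G \<subseteq> H \<Longrightarrow> H = G" by (auto simp: \<G>_def)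
  have max: "G' = G" if "partial_embedding G'" "G \<subseteq> G'" for G'
    using max'[of G'] that ran by (auto simp: \<G>_def)
  note cl = partial_embedding_closed[OF G]
  note z = graph_poly_zero_iff[OF G] and dg = graph_poly_degree[OF G]
  have inv: "(inverse a, inverse b) \<in> G" if "(a, b) \<in> G" "a \<noteq> 0" for a b
    by (rule maximal_partial_embedding_field[OF G max that])
  note division = maximal_partial_embedding_division[OF G inv]
  have total: "\<exists>f. (e, f) \<in> G" for e
  proof -
    \<comment> \<open>The degrees of nonzero annihilators of \<open>e\<close> over the domain of
      \<open>G\<close>; the least one belongs to the minimal polynomial \<open>p\<close>.\<close>
    define P where "P n \<longleftrightarrow> (\<exists>p p'. graph_poly G p p' \<and> p \<noteq> 0 \<and> poly p e = 0 \<and> degree p = n)" for n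
    obtain q where q: "q \<noteq> 0" "poly (map_poly i q) e = 0" using alg by blast
    have "graph_poly G (map_poly i q) (map_poly s q)"
      using ran by (auto simp: graph_poly_def coeff_map_poly)
    moreover have "map_poly i q \<noteq> 0" using q(1) i0 by (simp add: map_poly_eq_0_iff)
    ultimately have "P (degree (map_poly i q))" using q unfolding P_def by blast
    then have "P (LEAST n. P n)" by (rule LeastI)
    then obtain p p' where p: "graph_poly G p p'" "p \<noteq> 0" "poly p e = 0"
      and pmin: "degree p = (LEAST n. P n)" by (auto simp: P_def)
    have small: "r = 0" if "graph_poly G r r'" "poly r e = 0" "degree r < degree p" for r r'
      using that not_less_Least[of "degree r" P] by (auto simp: pmin P_def)
    have degp: "0 < degree p"
      using p(2,3) by (metis degree_eq_zeroE gr0I pCons_0_0 poly_const_conv)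
    then obtain f where f: "poly p' f = 0"
      using alg_closed_imp_poly_has_root[of p'] dg[OF p(1)] by auto
    \<comment> \<open>The image of \<open>p\<close> stays irreducible: a minimal annihilator
      \<open>g'\<close> of \<open>f\<close> of lower degree would divide \<open>p'\<close>, the
      division would pull back to \<open>p = d * g\<close>, and one of these smaller factors would
      vanish at \<open>e\<close>.\<close>
    have small': "r = 0" if r: "graph_poly G r r'" "poly r' f = 0" "degree r < degree p" for r r'
    proof (rule ccontr)
      assume "r \<noteq> 0"
      define Q where "Q n \<longleftrightarrow> (\<exists>g g'. graph_poly G g g' \<and> g \<noteq> 0 \<and> poly g' f = 0 \<and> degree g = n)" for n
      have Qr: "Q (degree r)" using r \<open>r \<noteq> 0\<close> unfolding Q_def by blast
      then have "Q (LEAST n. Q n)" by (rule LeastI)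
      then obtain g g' where g: "graph_poly G g g'" "g \<noteq> 0" "poly g' f = 0"
        and gmin: "degree g = (LEAST n. Q n)" by (auto simp: Q_def)
      have gr: "degree g \<le> degree r" unfolding gmin by (rule Least_le) (fact Qr)
      have "g' \<noteq> 0" using z g by blast
      then have "0 < degree g'"
        using g(3) by (metis degree_eq_zeroE gr0I pCons_0_0 poly_const_conv)
      then have gdeg: "0 < degree g" using dg[OF g(1)] by simp
      obtain d d' r2 r2' where d: "graph_poly G d d'" "graph_poly G r2 r2'" "p = d * g + r2"
        "p' = d' * g' + r2'" "r2 = 0 \<or> degree r2 < degree g"
        using division[OF _ _ g(1,2) p(1)] by blast
      have "poly r2' f = 0" using d(4) f g(3) by simp
      then have "r2 = 0"
        using d(2,5) not_less_Least[of "degree r2" Q] by (auto simp: gmin Q_def)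
      then have pe: "p = d * g" using d(3) by simp
      then have "d \<noteq> 0" using p(2) by auto
      have "degree p = degree d + degree g"
        unfolding pe by (rule degree_mult_eq) (fact \<open>d \<noteq> 0\<close> g(2))+
      then have "degree d < degree p" "degree g < degree p" using gdeg gr r(3) by auto
      moreover have "poly d e = 0 \<or> poly g e = 0" using p(3) pe by simp
      ultimately show False using small d(1) g(1,2) \<open>d \<noteq> 0\<close> by blast
    qed
    have "poly q e = 0 \<longleftrightarrow> poly q' f = 0" if q: "graph_poly G q q'" for q q'
    proof -
      obtain d d' r r' where d: "graph_poly G d d'" "graph_poly G r r'" "q = d * p + r"
        "q' = d' * p' + r'" "r = 0 \<or> degree r < degree p"
        using division[OF _ _ p(1,2) q] by blast
      have "poly q e = poly r e" "poly q' f = poly r' f" using d p(3) f by auto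
      moreover have "poly r e = 0 \<longleftrightarrow> r = 0" "poly r' f = 0 \<longleftrightarrow> r = 0"
        using d(5) small[OF d(2)] small'[OF d(2)] z[OF d(2)] by auto
      ultimately show ?thesis by simp
    qed
    from partial_embedding_adjoin[OF G this] show ?thesis using max by metis
  qed
  have uniq: "b = b'" if "(a, b) \<in> G" "(a, b') \<in> G" for a b b'
    using cl(5)[OF cl(2)[OF that(1) cl(4)[OF that(2)]]] by simp
  define \<tau> where "\<tau> e = (THE f. (e, f) \<in> G)" for e
  have \<tau>: "(e, \<tau> e) \<in> G" for e
    unfolding \<tau>_def using total uniq by (metis theI')
  have "cring_map \<tau>"
  proof
    fix x y
    show "\<tau> 1 = 1" by (rule uniq[OF \<tau> cl(1)])
    show "\<tau> (x + y) = \<tau> x + \<tau> y" by (rule uniq[OF \<tau> cl(2)[OF \<tau> \<tau>]])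
    show "\<tau> (x * y) = \<tau> x * \<tau> y" by (rule uniq[OF \<tau> cl(3)[OF \<tau> \<tau>]])
  qed
  moreover have "\<tau> (i r) = s r" for r using uniq \<tau> ran by blast
  ultimately show ?thesis by blast
qed

text \<open>The range is an isomorphic copy of an algebraically closed field: pull \<open>q\<close>
  back, split off linear factors there and map them forward.\<close>

lemma range_relatively_algebraically_closed:
  fixes h :: "'e::alg_closed_field \<Rightarrow> 'f::field"
  assumes h: "cring_map h" and c: "\<And>n. coeff q n \<in> range h" and "q \<noteq> 0" and r: "poly q x = 0"
  shows "x \<in> range h"
proof -
  interpret cring_map h by fact
  have inj: "h a = h b \<longleftrightarrow> a = b" for a b using cring_map_field_inj[OF h] by (auto dest: injD)
  have h0: "h a = 0 \<longleftrightarrow> a = 0" for a using inj[of a 0] by simp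
  define p where "p = map_poly (inv_into UNIV h) q"
  have "inv_into UNIV h 0 = 0" using inj inv_f_f[OF cring_map_field_inj[OF h], of 0] by simp
  then have qp: "q = map_poly h p"
    using c by (auto simp: p_def poly_eq_iff coeff_map_poly f_inv_into_f)
  then have p0: "p \<noteq> 0" using \<open>q \<noteq> 0\<close> by auto
  have "poly (map_poly h p) x = 0 \<Longrightarrow> p \<noteq> 0 \<Longrightarrow> x \<in> range h"
  proof (induction "degree p" arbitrary: p rule: less_induct)
    case less
    show ?case
    proof (cases "degree p = 0")
      case True
      then obtain a where "p = [:a:]" by (elim degree_eq_zeroE)
      then show ?thesis using less.prems h0 by (simp add: map_poly_pCons)
    next
      case False
      then obtain a where "poly p a = 0" using alg_closed_imp_poly_has_root by blast
      then obtain p2 where p2: "p = [:- a, 1:] * p2" by (metis poly_eq_0_iff_dvd dvdE)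
      have "map_poly h p = [:- h a, 1:] * map_poly h p2"
        unfolding p2 by (rule poly_eqI) (auto simp: coeff_map_poly coeff_pCons split: nat.split)
      then have "x = h a \<or> poly (map_poly h p2) x = 0" using less.prems(1) by auto
      moreover have "degree p2 < degree p"
        using less.prems(2) unfolding p2 by (subst degree_mult_eq) auto
      moreover have "p2 \<noteq> 0" using less.prems(2) p2 by auto
      ultimately show ?thesis using less.hyps by blast
    qed
  qed
  then show ?thesis using r p0 qp by simp
qed

section \<open>Difference polynomials in one variable over an ACFA\<close>

lemma mp_vars_const: "mp_vars (mp_const c) = {}"
  by (auto simp: mp_vars_def mp_const_def)

lemma mp_vars_var: "mp_vars (mp_var v) \<subseteq> {v}"
  by (auto simp: mp_vars_def mp_var_def)

lemma mp_vars_add: "mp_vars (p + q) \<subseteq> mp_vars p \<union> mp_vars q"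
  using keys_add[of p q] by (force simp: mp_vars_def)

lemma mp_vars_mult: "mp_vars (p * q) \<subseteq> mp_vars p \<union> mp_vars q"
proof
  fix v assume "v \<in> mp_vars (p * q)"
  then obtain e where "e \<in> Poly_Mapping.keys (p * q)" "v \<in> Poly_Mapping.keys e"
    by (auto simp: mp_vars_def)
  moreover then obtain a b where "e = a + b" "a \<in> Poly_Mapping.keys p" "b \<in> Poly_Mapping.keys q"
    using keys_mult[of p q] by blast
  ultimately show "v \<in> mp_vars p \<union> mp_vars q"
    using keys_add[of a b] by (auto simp: mp_vars_def)
qed

lemma mp_vars_mp_eval:
  fixes p :: "('v, 'a::comm_ring_1) mpol" and x :: "'v \<Rightarrow> ('w, 'a) mpol"
  assumes "\<And>v. v \<in> mp_vars p \<Longrightarrow> mp_vars (x v) \<subseteq> A"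
  shows "mp_vars (mp_eval mp_const x p) \<subseteq> A"
proof (rule mp_eval_rel[where R = "\<lambda>a _. mp_vars a \<subseteq> A" and h' = mp_const and q = p and y = x])
  interpret cring_map "mp_const :: 'a \<Rightarrow> ('w, 'a) mpol" by (rule cring_map_mp_const)
  show "mp_const (0 :: 'a) = (0 :: ('w, 'a) mpol)" "mp_const (0 :: 'a) = (0 :: ('w, 'a) mpol)" by simp_all
  show "mp_vars (1 :: ('w, 'a) mpol) \<subseteq> A" using mp_vars_const[of 1] hom_one by (metis empty_subsetI)
  show "mp_vars (0 :: ('w, 'a) mpol) \<subseteq> A" by (simp add: mp_vars_def)
  show "mp_vars (a + c) \<subseteq> A" "mp_vars (a * c) \<subseteq> A" if "mp_vars a \<subseteq> A" "mp_vars c \<subseteq> A"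
    for a c :: "('w, 'a) mpol" and b d :: "('w, 'a) mpol"
    using that mp_vars_add[of a c] mp_vars_mult[of a c] by blast+
qed (use assms in \<open>auto simp: mp_vars_const\<close>)

text \<open>Isolating variable \<open>m\<close> makes facts about roots of univariate polynomials
  applicable; the value \<open>b m\<close> does not matter.\<close>

definition mp_univ :: "('a \<Rightarrow> 'b::comm_ring_1) \<Rightarrow> ('v \<Rightarrow> 'b) \<Rightarrow> 'v \<Rightarrow> ('v, 'a::comm_ring_1) mpol \<Rightarrow> 'b poly" where
  "mp_univ h b m p = mp_eval (\<lambda>c. [:h c:]) (\<lambda>i. if i = m then [:0, 1:] else [:b i:]) p"

lemma cring_map_poly: "cring_map (\<lambda>p. poly p (z :: 'a::comm_ring_1))"
  by unfold_locales auto

lemma cring_map_const_poly: "cring_map h \<Longrightarrow> cring_map (\<lambda>c. [:h c:])"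
  by (auto simp: cring_map_def one_pCons)

lemma poly_mp_univ: "poly (mp_univ h b m p) z = mp_eval h (b(m := z)) p"
  unfolding mp_univ_def cring_map.hom_mp_eval[OF cring_map_poly]
  by (simp add: fun_upd_def if_distrib[of "\<lambda>p. poly p z"] cong: if_cong)

lemma coeff_mp_univ:
  assumes g: "cring_map (g :: 'c::comm_ring_1 \<Rightarrow> 'b::comm_ring_1)" and h: "cring_map h"
    and hc: "\<And>c. h c \<in> range g" and b: "\<And>i. i \<in> mp_vars p \<Longrightarrow> i \<noteq> m \<Longrightarrow> b i \<in> range g"
  shows "coeff (mp_univ h b m p) n \<in> range g"
proof -
  interpret g: cring_map g by fact
  interpret h: cring_map h by fact
  have z: "0 \<in> range g" and o: "1 \<in> range g" using g.hom_zero g.hom_one by (metis rangeI)+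
  have a: "x + y \<in> range g" and t: "x * y \<in> range g" if "x \<in> range g" "y \<in> range g" for x y
    using that by (auto simp flip: g.hom_add g.hom_mult)
  have s: "sum f A \<in> range g" if "\<And>i. i \<in> A \<Longrightarrow> f i \<in> range g" for f and A :: "nat set"
    using that by (induction A rule: infinite_finite_induct) (auto intro: z a)
  define P where "P a \<longleftrightarrow> (\<forall>n. coeff a n \<in> range g)" for a :: "'b poly"
  have Pc: "P [:c:]" if "c \<in> range g" for c
    using that z by (auto simp: P_def coeff_pCons split: nat.split)
  have "P (mp_univ h b m p)"
    unfolding mp_univ_def
  proof (rule mp_eval_rel[where R = "\<lambda>a _. P a" and h' = "\<lambda>c. [:h c:]" and q = p
          and y = "\<lambda>i. if i = m then [:0, 1:] else [:b i:]"])
    show "P 0" "P 1" using Pc[OF z] Pc[OF o] by (simp_all add: one_pCons)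
    fix u w :: "'b poly" assume "P u" "P w"
    then have u: "coeff u n \<in> range g" and w: "coeff w n \<in> range g" for n by (auto simp: P_def)
    show "P (u + w)" unfolding P_def coeff_add by (intro allI a u w)
    show "P (u * w)" unfolding P_def coeff_mult by (intro allI s t u w)
  next
    show "P (if i = m then [:0, 1:] else [:b i:])" if "i \<in> mp_vars p \<union> mp_vars p" for i
      using that b z o Pc by (auto simp: P_def coeff_pCons split: nat.split)
  qed (simp_all add: Pc hc)
  then show ?thesis by (simp add: P_def)
qed

section \<open>The algebraic closure of k(X_0, X_1, ...)\<close>

type_synonym 'k ratfun_closure = "(nat, 'k) mpol fract alg_closure"

definition ratfun_of :: "(nat, 'k::field_char_0) mpol \<Rightarrow> 'k ratfun_closure" where
  "ratfun_of p = to_ac (Fract p 1)"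

text \<open>There are infinitely many generators because a type cannot depend on the order of the
  equation; those beyond the order will be fixed by the automorphism.\<close>

definition gen :: "nat \<Rightarrow> 'k::field_char_0 ratfun_closure" where
  "gen j = ratfun_of (mp_var j)"

definition kconst :: "'k::field_char_0 \<Rightarrow> 'k ratfun_closure" where
  "kconst c = ratfun_of (mp_const c)"

lemma cring_map_ratfun_of: "cring_map ratfun_of"
  by unfold_locales
     (auto simp: ratfun_of_def eq_fract simp flip: to_ac_add to_ac_mult One_fract_def)

lemma inj_ratfun_of: "inj ratfun_of"
  by (rule injI) (simp add: ratfun_of_def eq_fract)

lemma ratfun_of_eq_0_iff [simp]: "ratfun_of p = 0 \<longleftrightarrow> p = 0"
  using inj_ratfun_of cring_map.hom_zero[OF cring_map_ratfun_of] by (metis injD)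

lemma cring_map_kconst: "cring_map kconst"
  unfolding kconst_def by (rule cring_map_comp[OF cring_map_ratfun_of cring_map_mp_const])

lemma ratfun_of_eq_mp_eval: "ratfun_of p = mp_eval kconst gen p"
  using cring_map.hom_mp_eval[OF cring_map_ratfun_of, of mp_const mp_var p]
  by (simp add: mp_eval_self kconst_def[abs_def] gen_def[abs_def])

lemma fract_poly_clear_denominators:
  fixes p :: "'r::idom fract poly"
  shows "\<exists>d q. d \<noteq> 0 \<and> smult (Fract d 1) p = map_poly (\<lambda>r. Fract r 1) q"
proof (induction p)
  case 0
  show ?case by (intro exI[of _ 1] exI[of _ 0]) auto
next
  case (pCons a p)
  then obtain d q where d: "d \<noteq> 0" "smult (Fract d 1) p = map_poly (\<lambda>r. Fract r 1) q" by blast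
  obtain u w where a: "a = Fract u w" "w \<noteq> 0" by (cases a) auto
  have F: "Fract (0::'r) 1 = 0" by (simp add: Zero_fract_def)
  have "smult (Fract (d * w) 1) (pCons a p)
      = pCons (Fract (d * u) 1) (smult (Fract w 1) (smult (Fract d 1) p))"
    using a by (simp add: eq_fract mult.commute)
  also have "smult (Fract w 1) (smult (Fract d 1) p) = map_poly (\<lambda>r. Fract r 1) (smult w q)"
    unfolding d(2) by (rule poly_eqI) (simp add: coeff_map_poly F)
  finally show ?case
    using d(1) a(2) F
    by (intro exI[of _ "d * w"] exI[of _ "pCons (d * u) (smult w q)"]) (auto simp: map_poly_pCons)
qed

lemma ratfun_closure_algebraic:
  "\<exists>q. q \<noteq> 0 \<and> poly (map_poly ratfun_of q) (e :: 'k::field_char_0 ratfun_closure) = 0"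
proof -
  obtain p :: "(nat, 'k) mpol fract poly" where p: "p \<noteq> 0" "poly (map_poly to_ac p) e = 0"
    using alg_closure_algebraic by blast
  obtain d q where d: "d \<noteq> 0" "smult (Fract d 1) p = map_poly (\<lambda>r. Fract r 1) q"
    using fract_poly_clear_denominators by blast
  have F: "Fract (0::(nat, 'k) mpol) 1 = 0" by (simp add: Zero_fract_def)
  have d0: "Fract d 1 \<noteq> 0" using d(1) by (simp add: Zero_fract_def eq_fract)
  have "q \<noteq> 0" using d d0 p(1) by auto
  have "map_poly ratfun_of q = map_poly to_ac (map_poly (\<lambda>r. Fract r 1) q)"
    by (rule poly_eqI) (simp add: coeff_map_poly F ratfun_of_def)
  also have "\<dots> = map_poly to_ac (smult (Fract d 1) p)" by (simp only: d(2))
  also have "map_poly to_ac (smult (Fract d 1) p) = smult (to_ac (Fract d 1)) (map_poly to_ac p)"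
    by (rule poly_eqI) (simp add: coeff_map_poly)
  finally have "poly (map_poly ratfun_of q) e = 0" using p(2) by simp
  then show ?thesis using \<open>q \<noteq> 0\<close> by blast
qed

text \<open>The assumption \<open>inj\<close> states that the prescribed images of the generators
  are algebraically independent over the range of \<open>h\<close>, which is what an embedding of
  the polynomial ring requires.\<close>

lemma ratfun_closure_endomorphism:
  fixes h :: "'k::field_char_0 \<Rightarrow> 'k ratfun_closure"
  assumes h: "cring_map h" and inj: "\<And>p. mp_eval h x p = 0 \<Longrightarrow> p = 0"
  obtains \<tau> :: "'k ratfun_closure \<Rightarrow> 'k ratfun_closure"
    where "cring_map \<tau>" "\<And>c. \<tau> (kconst c) = h c" "\<And>j. \<tau> (gen j) = x j"
proof -
  note hom = cring_map.mp_eval_hom[OF h, of x]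
  have "inj (mp_eval h x)"
  proof (rule injI)
    fix p q assume "mp_eval h x p = mp_eval h x q"
    then have "mp_eval h x (p - q) = 0" by (simp add: cring_map.hom_diff[OF hom])
    then show "p = q" using inj[of "p - q"] by simp
  qed
  from embedding_extension[OF cring_map_ratfun_of inj_ratfun_of hom this ratfun_closure_algebraic]
  obtain \<tau> :: "'k ratfun_closure \<Rightarrow> 'k ratfun_closure"
    where "cring_map \<tau>" "\<And>p. \<tau> (ratfun_of p) = mp_eval h x p" by blast
  then show ?thesis
    by (intro that) (auto simp: kconst_def gen_def cring_map.mp_eval_const[OF h] cring_map.mp_eval_var[OF h])
qed

section \<open>Endomorphisms that omit one variable\<close>

definition skip :: "nat \<Rightarrow> nat \<Rightarrow> nat" where
  "skip j i = (if i < j then i else Suc i)"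

definition unskip :: "nat \<Rightarrow> nat \<Rightarrow> nat" where
  "unskip j i = (if i < j then i else i - 1)"

lemma skip_simps [simp]: "unskip j (skip j i) = i" "skip j i \<noteq> j" "i \<noteq> j \<Longrightarrow> skip j (unskip j i) = i"
  by (auto simp: skip_def unskip_def)

lemma mp_rename_rename:
  fixes p :: "('u, 'a::comm_ring_1) mpol"
  shows "mp_eval mp_const x (mp_eval mp_const (\<lambda>i. mp_var (f i)) p) = mp_eval mp_const (\<lambda>i. x (f i)) p"
  using cring_map.hom_mp_eval[OF cring_map.mp_eval_hom[OF cring_map_mp_const],
      of x mp_const "\<lambda>i. mp_var (f i)" p]
  by (simp add: cring_map.mp_eval_const[OF cring_map_mp_const] cring_map.mp_eval_var[OF cring_map_mp_const])

text \<open>The range of such an \<open>h\<close> is an algebraic closure of the field generated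
  over k by all X_i with i different from \<open>j\<close>. Lying outside it expresses algebraic
  dependence on X_j.\<close>

lemma skip_endomorphism_exists:
  obtains h :: "'k::field_char_0 ratfun_closure \<Rightarrow> 'k ratfun_closure"
    where "cring_map h" "\<And>c. h (kconst c) = kconst c" "\<And>i. h (gen i) = gen (skip j i)"
proof (rule ratfun_closure_endomorphism[OF cring_map_kconst, of "\<lambda>i. gen (skip j i)"])
  fix p :: "(nat, 'k) mpol"
  assume z: "mp_eval kconst (\<lambda>i. gen (skip j i)) p = 0"
  let ?r = "mp_eval mp_const (\<lambda>i. mp_var (skip j i)) p :: (nat, 'k) mpol"
  have "ratfun_of ?r = mp_eval kconst (\<lambda>i. gen (skip j i)) p"
    by (simp add: cring_map.hom_mp_eval[OF cring_map_ratfun_of] gen_def flip: kconst_def)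
  then have "?r = 0" using z by simp
  then have "mp_eval mp_const (\<lambda>i. mp_var (unskip j i)) ?r = (0 :: (nat, 'k) mpol)"
    by (simp add: mp_eval_def)
  then show "p = 0" unfolding mp_rename_rename by (simp add: mp_eval_self)
qed (use that in blast)

text \<open>If X_j = h(e), then \<open>h\<close> turns an algebraic equation of \<open>e\<close>
  into one for X_j whose coefficients do not involve X_j; such an equation must be trivial.\<close>

lemma gen_notin_skip_range:
  fixes h :: "'k::field_char_0 ratfun_closure \<Rightarrow> 'k ratfun_closure"
  assumes h: "cring_map h" and hk: "\<And>c. h (kconst c) = kconst c"
    and hg: "\<And>i. h (gen i) = gen (skip j i)"
  shows "gen j \<notin> range h"
proof
  interpret h: cring_map h by fact
  assume "gen j \<in> range h"
  then obtain e where e: "gen j = h e" by blast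
  obtain q where q: "q \<noteq> 0" "poly (map_poly ratfun_of q) e = 0"
    using ratfun_closure_algebraic by blast
  define ren :: "(nat, 'k) mpol \<Rightarrow> (nat, 'k) mpol"
    where "ren = mp_eval mp_const (\<lambda>i. mp_var (skip j i))"
  interpret ren: cring_map ren unfolding ren_def by (rule cring_map.mp_eval_hom[OF cring_map_mp_const])
  interpret E: cring_map "ratfun_of :: (nat, 'k) mpol \<Rightarrow> _" by (rule cring_map_ratfun_of)
  have hr: "h (ratfun_of p) = ratfun_of (ren p)" for p
    by (simp add: ren_def E.hom_mp_eval ratfun_of_eq_mp_eval[of p] h.hom_mp_eval hk hg
        flip: kconst_def gen_def)
  have "h (poly (map_poly ratfun_of q) e) = 0" using q(2) by simp
  moreover have "map_poly h (map_poly ratfun_of q) = map_poly ratfun_of (map_poly ren q)"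
    by (rule poly_eqI) (simp add: coeff_map_poly hr)
  ultimately have "ratfun_of (poly (map_poly ren q) (mp_var j)) = 0"
    by (simp add: h.hom_poly E.hom_poly e[symmetric] gen_def)
  then have z: "poly (map_poly ren q) (mp_var j) = 0" by simp
  \<comment> \<open>Reads X_j as the indeterminate of a univariate polynomial and undoes the
    renumbering of the other variables. It sends the value at X_j of the renamed \<open>q\<close>
    back to \<open>q\<close> itself.\<close>
  define sep :: "(nat, 'k) mpol \<Rightarrow> (nat, 'k) mpol poly"
    where "sep = mp_univ mp_const (\<lambda>i. mp_var (unskip j i)) j"
  have c: "cring_map (\<lambda>c. [:mp_const c :: (nat, 'k) mpol:])"
    by (rule cring_map_const_poly[OF cring_map_mp_const])
  interpret sep: cring_map sep unfolding sep_def mp_univ_def by (rule cring_map.mp_eval_hom[OF c])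
  interpret C: cring_map "\<lambda>c. [:c :: (nat, 'k) mpol:]" by (rule cring_map_const_poly[OF cring_map_id])
  have sc: "sep (mp_const a) = [:mp_const a:]"
    and sv: "sep (mp_var i) = (if i = j then [:0, 1:] else [:mp_var (unskip j i):])" for a i
    unfolding sep_def mp_univ_def by (rule cring_map.mp_eval_const[OF c] cring_map.mp_eval_var[OF c])+
  have sr: "sep (ren p) = [:p:]" for p
    using C.hom_mp_eval[of mp_const mp_var p]
    by (simp add: ren_def sep.hom_mp_eval sc sv mp_eval_self)
  have "map_poly sep (map_poly ren q) = map_poly (\<lambda>c. [:c:]) q"
    by (rule poly_eqI) (simp add: coeff_map_poly sr)
  then have "sep (poly (map_poly ren q) (mp_var j)) = q"
    unfolding sep.hom_poly sv by (simp only: if_True refl pcompose_idR flip: pcompose_altdef)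
  then show False using z q(1) by simp
qed

lemma difference_poly_eval_type:
  fixes h :: "'k::zero \<Rightarrow> 'l::field"
  shows "difference_poly_eval ring_of_type_algebra \<tau> h p a
       = mp_eval h (\<lambda>ij. (\<tau> ^^ snd ij) (a (fst ij))) p"
proof -
  let ?L = "ring_of_type_algebra :: 'l ring"
  interpret L: field ?L by (rule field_from_type_algebra)
  have c [simp]: "carrier ?L = UNIV" "\<one>\<^bsub>?L\<^esub> = 1" "\<zero>\<^bsub>?L\<^esub> = 0"
    "x \<otimes>\<^bsub>?L\<^esub> y = x * y" "x \<oplus>\<^bsub>?L\<^esub> y = x + y" for x y
    by (simp_all add: ring_of_type_algebra_def)
  have p [simp]: "x [^]\<^bsub>?L\<^esub> (n::nat) = x ^ n" for x n
    by (induction n) (simp_all add: L.nat_pow_Suc mult.commute)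
  have [simp]: "finsum ?L f A = sum f A" if "finite A" for f and A :: "('b \<Rightarrow>\<^sub>0 nat) set"
    using that by (induction A rule: finite_induct) (auto simp: L.finsum_insert)
  have [simp]: "finprod ?L f A = prod f A" if "finite A" for f and A :: "'b set"
    using that by (induction A rule: finite_induct) (auto simp: L.finprod_insert)
  show ?thesis by (simp add: difference_poly_eval_def mp_eval_def mono_eval_def)
qed

lemma ratfun_of_mp_eval:
  "ratfun_of (mp_eval mp_const x p) = mp_eval kconst (\<lambda>i. ratfun_of (x i)) p"
  by (simp add: cring_map.hom_mp_eval[OF cring_map_ratfun_of] kconst_def[abs_def])

text \<open>In degree zero, putting 0 for X_m would leave \<open>P\<close> unchanged, so
  \<open>P\<close> would equal a polynomial without X_m.\<close>

lemma degree_mp_univ_gen: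
  fixes P :: "(nat, 'k::field_char_0) mpol"
  assumes "m \<in> mp_vars P" shows "0 < degree (mp_univ kconst gen m P)"
proof (rule ccontr)
  assume "\<not> ?thesis"
  then obtain a where a: "mp_univ kconst gen m P = [:a:]" by (auto elim: degree_eq_zeroE)
  have "poly (mp_univ kconst gen m P) (gen m) = poly (mp_univ kconst gen m P) 0"
    unfolding a by simp
  then have e: "mp_eval kconst gen P = mp_eval kconst (gen(m := 0)) P" by (simp add: poly_mp_univ)
  let ?P0 = "mp_eval mp_const (mp_var(m := 0)) P :: (nat, 'k) mpol"
  have "ratfun_of P = ratfun_of ?P0"
    using e unfolding ratfun_of_mp_eval ratfun_of_eq_mp_eval[of P]
    by (simp add: fun_upd_def gen_def[abs_def] if_distrib[of ratfun_of] cring_map.hom_zero[OF cring_map_ratfun_of]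
        cong: if_cong)
  then have "P = ?P0" using inj_ratfun_of by (auto dest: injD)
  moreover have "mp_vars ?P0 \<subseteq> - {m}"
  proof (rule mp_vars_mp_eval)
    fix v show "mp_vars ((mp_var(m := 0)) v :: (nat, 'k) mpol) \<subseteq> - {m}"
      using mp_vars_var[of v] by (auto simp: mp_vars_def)
  qed
  ultimately show False using assms by auto
qed

lemma poly_zero_on_kconst:
  fixes q :: "'k::field_char_0 ratfun_closure poly"
  assumes "\<And>c. poly q (kconst c) = 0" shows "q = 0"
proof (rule ccontr)
  assume "q \<noteq> 0"
  then have "finite {x. poly q x = 0}" by (rule poly_roots_finite)
  then have "finite (range (kconst :: 'k \<Rightarrow> _))"
    by (rule finite_subset[rotated]) (use assms in auto)
  then show False
    using cring_map_field_inj[OF cring_map_kconst] infinite_UNIV_char_0 finite_imageD by blast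
qed

text \<open>Applying the inverse of \<sigma> to the coefficients and \<open>\<pi>'\<close> to the
  indices undoes the evaluation.\<close>

lemma mp_eval_permuted_gen:
  assumes \<sigma>: "field_automorphism (\<sigma> :: 'k::field_char_0 \<Rightarrow> 'k)" and \<pi>: "\<And>i :: nat. \<pi>' (\<pi> i) = (i :: nat)"
    and z: "mp_eval (\<lambda>c. kconst (\<sigma> c)) (\<lambda>i. gen (\<pi> i)) p = 0"
  shows "p = 0"
proof -
  interpret \<sigma>: cring_map \<sigma> by (rule field_automorphism_cring_map[OF \<sigma>])
  have \<sigma>i: "\<And>c. inv_into UNIV \<sigma> (\<sigma> c) = c" "\<And>c. \<sigma> (inv_into UNIV \<sigma> c) = c"
    using \<sigma> by (auto simp: field_automorphism_def bij_def surj_f_inv_f)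
  have \<sigma>e: "c = d" if "\<sigma> c = \<sigma> d" for c d using that \<sigma>i(1) by metis
  interpret \<sigma>i: cring_map "inv_into UNIV \<sigma>"
    by unfold_locales (rule \<sigma>e, simp add: \<sigma>i(2))+
  let ?h = "\<lambda>c. mp_const (\<sigma> c) :: (nat, 'k) mpol"
  let ?g = "mp_eval (\<lambda>c. mp_const (inv_into UNIV \<sigma> c) :: (nat, 'k) mpol) (\<lambda>i. mp_var (\<pi>' i))"
  have hi: "cring_map (\<lambda>c. mp_const (inv_into UNIV \<sigma> c) :: (nat, 'k) mpol)"
    by (rule cring_map_comp[OF cring_map_mp_const \<sigma>i.cring_map_axioms])
  have "ratfun_of (mp_eval ?h (\<lambda>i. mp_var (\<pi> i)) p) = 0"
    using z by (simp add: cring_map.hom_mp_eval[OF cring_map_ratfun_of] kconst_def gen_def)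
  then have "?g (mp_eval ?h (\<lambda>i. mp_var (\<pi> i)) p) = 0" by (simp add: mp_eval_def)
  then have "mp_eval mp_const mp_var p = 0"
    by (simp add: cring_map.hom_mp_eval[OF cring_map.mp_eval_hom[OF hi]]
        cring_map.mp_eval_const[OF hi] cring_map.mp_eval_var[OF hi] \<sigma>i \<pi>)
  then show ?thesis by (simp add: mp_eval_self)
qed

text \<open>Let \<open>m\<close> be the order of \<open>P\<close>, let \<open>y\<close> solve \<open>P(X\<^sub>0, \<dots>, X\<^bsub>m-1\<^esub>, y) = 0\<close>, and let \<open>r\<close> be
  minimal such that \<open>y\<close> is algebraically dependent on \<open>X\<^sub>r\<close> over the other variables (\<open>r = m\<close> if there is
  none). Then \<open>X\<^sub>r \<mapsto> X\<^bsub>r+1\<^esub> \<mapsto> \<dots> \<mapsto> X\<^bsub>m-1\<^esub> \<mapsto> y\<close>, with all other variables fixed,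
  extends to an automorphism \<open>\<tau>\<close>, and \<open>\<tau>\<^bsup>-r\<^esup> X\<^sub>r\<close> is a root, since the equation does not involve the
  variables before \<open>X\<^sub>r\<close>. Independence of \<open>X\<^sub>j\<close> is membership in the range of an endomorphism that
  shifts the variables past \<open>X\<^sub>j\<close>.\<close>

lemma difference_poly_root_in_extension:
  fixes \<sigma> :: "'k::field_char_0 \<Rightarrow> 'k" and P :: "(nat, 'k) mpol"
  assumes \<sigma>: "field_automorphism \<sigma>" and ne: "mp_vars P \<noteq> {}"
  obtains \<tau> :: "'k ratfun_closure \<Rightarrow> 'k ratfun_closure" and x
  where "cring_map \<tau>" "bij \<tau>" "\<And>c. \<tau> (kconst c) = kconst (\<sigma> c)"
    "mp_eval kconst (\<lambda>j. (\<tau> ^^ j) x) P = 0"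
proof -
  note kc = cring_map_kconst
  have P0: "P \<noteq> 0" using ne by (auto simp: mp_vars_def)
  have \<sigma>s: "surj \<sigma>" using \<sigma> by (auto simp: field_automorphism_def bij_def)
  have k\<sigma>: "cring_map (\<lambda>c. kconst (\<sigma> c))"
    by (rule cring_map_comp[OF kc field_automorphism_cring_map[OF \<sigma>]])
  define m where "m = Max (mp_vars P)"
  have m: "m \<in> mp_vars P" and mle: "\<And>i. i \<in> mp_vars P \<Longrightarrow> i \<le> m"
    unfolding m_def using Max_in[OF finite_mp_vars ne] Max_ge[OF finite_mp_vars] by auto
  obtain y where "poly (mp_univ kconst gen m P) y = 0"
    using alg_closed_imp_poly_has_root degree_mp_univ_gen[OF m] by blast
  then have y: "mp_eval kconst (gen(m := y)) P = 0" by (simp add: poly_mp_univ)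
  have "\<exists>h. \<forall>j. cring_map (h j) \<and> (\<forall>c. h j (kconst c) = kconst c) \<and> (\<forall>i. h j (gen i) = gen (skip j i))"
    for u :: 'k
    by (intro choice allI) (metis skip_endomorphism_exists)
  then obtain H :: "nat \<Rightarrow> 'k ratfun_closure \<Rightarrow> 'k ratfun_closure"
    where H: "\<And>j. cring_map (H j)" "\<And>j c. H j (kconst c) = kconst c" "\<And>j i. H j (gen i) = gen (skip j i)"
    by blast
  \<comment> \<open>The algebraic closure of the field generated by the variables other than
    X_j.\<close>
  define C where "C j = range (H j)" for j
  have Ck: "kconst c \<in> C j" for c j using H(2) unfolding C_def by (metis rangeI)
  have Cg: "gen i \<in> C j" if "i \<noteq> j" for i j
    using H(3)[of j "unskip j i"] that unfolding C_def by (metis rangeI skip_simps(3))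
  have Cn: "gen j \<notin> C j" for j
    unfolding C_def by (rule gen_notin_skip_range) (fact H)+
  \<comment> \<open>Elements outside \<open>C j\<close> are transcendental over it, as it is
    algebraically closed. This is the independence argument used throughout below.\<close>
  have Cclosed: "q = 0" if "\<And>n. coeff q n \<in> C j" "poly q z = 0" "z \<notin> C j" for q j z
    using range_relatively_algebraically_closed[OF H(1), of q j z] that unfolding C_def by blast
  have Cc: "coeff (mp_univ h b i p) n \<in> C j"
    if "cring_map h" "\<And>c. h c \<in> range kconst" "\<And>l. l \<in> mp_vars p \<Longrightarrow> l \<noteq> i \<Longrightarrow> b l \<in> C j"
    for h :: "'k \<Rightarrow> _" and b i p j n
    unfolding C_def
  proof (rule coeff_mp_univ[OF H(1) that(1)])
    show "h c \<in> range (H j)" for c using that(2)[of c] Ck by (auto simp: C_def)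
  qed (use that(3) in \<open>simp add: C_def\<close>)
  define r where "r = (LEAST j. j = m \<or> y \<notin> C j)"
  have r: "r = m \<or> y \<notin> C r" unfolding r_def by (rule LeastI[of _ m]) simp
  have rm: "r \<le> m" unfolding r_def by (rule Least_le) simp
  have rmin: "y \<in> C j" if "j < r" for j using not_less_Least that unfolding r_def by blast
  \<comment> \<open>The intended values of x, \<tau> x, ..., \<tau>^m x from position
    \<open>r\<close> on.\<close>
  define b where "b = gen(m := y)"
  define s where "s j = (if r \<le> j \<and> j < m then b (Suc j) else gen j)" for j
  have sinj: "p = 0" if z: "mp_eval (\<lambda>c. kconst (\<sigma> c)) s p = 0" for p
  proof (cases "r = m")
    case True
    then have "s = (\<lambda>i. gen i)" by (intro ext) (auto simp: s_def)
    then show ?thesis using mp_eval_permuted_gen[OF \<sigma>, of "\<lambda>i. i" "\<lambda>i. i" p] z by simp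
  next
    case False
    then have lt: "r < m" and yC: "y \<notin> C r" using r rm by auto
    \<comment> \<open>In the list \<open>s\<close> the element \<open>y\<close> stands at
      \<open>m - 1\<close> and no other entry involves X_r. As \<open>y\<close> is transcendental
      over \<open>C r\<close>, it may be replaced by X_r, which leaves a cyclic permutation of the
      variables.\<close>
    let ?q = "mp_univ (\<lambda>c. kconst (\<sigma> c)) s (m - 1) p"
    have "coeff ?q n \<in> C r" for n
      by (rule Cc[OF k\<sigma>]) (use lt in \<open>auto simp: s_def b_def intro!: Cg\<close>)
    moreover have "s(m - 1 := y) = s" using lt by (intro ext) (auto simp: s_def b_def)
    then have "poly ?q y = 0" using z by (simp add: poly_mp_univ)
    ultimately have "?q = 0" using Cclosed yC by blast
    then have "mp_eval (\<lambda>c. kconst (\<sigma> c)) (s(m - 1 := gen r)) p = 0"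
      by (simp flip: poly_mp_univ)
    moreover define \<pi> where "\<pi> j = (if r \<le> j \<and> j < m then (if j = m - 1 then r else Suc j) else j)" for j
    moreover have "s(m - 1 := gen r) = (\<lambda>i. gen (\<pi> i))"
      using lt by (intro ext) (auto simp: s_def b_def \<pi>_def)
    moreover define \<pi>' where "\<pi>' j = (if r \<le> j \<and> j < m then (if j = r then m - 1 else j - 1) else j)" for j
    moreover have "\<pi>' (\<pi> i) = i" for i using lt by (auto simp: \<pi>_def \<pi>'_def)
    ultimately show ?thesis using mp_eval_permuted_gen[OF \<sigma>] by metis
  qed
  obtain \<tau> :: "'k ratfun_closure \<Rightarrow> 'k ratfun_closure"
    where \<tau>: "cring_map \<tau>" "\<And>c. \<tau> (kconst c) = kconst (\<sigma> c)" "\<And>j. \<tau> (gen j) = s j"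
    using ratfun_closure_endomorphism[OF k\<sigma> sinj] by blast
  interpret \<tau>: cring_map \<tau> by fact
  have Tk: "kconst c \<in> range \<tau>" for c using \<sigma>s \<tau>(2) by (metis rangeI surjD)
  have Ts: "s j \<in> range \<tau>" for j using \<tau>(3) by (metis rangeI)
  have Tg: "gen k \<in> range \<tau>" for k
  proof -
    have other: "gen k \<in> range \<tau>" if "k \<noteq> r \<or> r = m" for k
    proof (cases "r < k \<and> k < m")
      case True
      then have "s (k - 1) = gen k" by (auto simp: s_def b_def)
      then show ?thesis using Ts by metis
    next
      case False
      then have "s k = gen k" using that by (auto simp: s_def)
      then show ?thesis using Ts by metis
    qed
    \<comment> \<open>X_r is the only generator missing from \<open>s\<close>. It is algebraic over
      the other generators and \<open>y\<close> by the equation for \<open>y\<close>, provided that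
      this equation is nontrivial in position \<open>r\<close>.\<close>
    have "gen r \<in> range \<tau>" if lt: "r < m"
    proof (rule range_relatively_algebraically_closed[OF \<tau>(1)])
      have yC: "y \<notin> C r" using r lt by auto
      have "s (m - 1) = y" using lt by (auto simp: s_def b_def)
      then have yT: "y \<in> range \<tau>" using Ts by metis
      let ?q = "mp_univ kconst b r P"
      show "coeff ?q n \<in> range \<tau>" for n
        by (rule coeff_mp_univ[OF \<tau>(1) kc Tk]) (use other yT in \<open>auto simp: b_def\<close>)
      have "b(r := gen r) = b" using lt by (intro ext) (auto simp: b_def)
      then show "poly ?q (gen r) = 0" using y by (simp add: poly_mp_univ b_def)
      show "?q \<noteq> 0"
      proof
        assume q0: "?q = 0"
        \<comment> \<open>If the equation were trivial in X_r, any constant could stand there; the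
          result is an equation for \<open>y\<close> over \<open>C r\<close>, hence trivial in X_m
          as well. So \<open>P\<close> would vanish whenever X_r is a constant, and thus be
          zero.\<close>
        have "poly (mp_univ kconst gen r P) (kconst c) = 0" for c
        proof -
          let ?q3 = "mp_univ kconst (gen(r := kconst c)) m P"
          have "coeff ?q3 n \<in> C r" for n
            by (rule Cc[OF kc]) (use Ck Cg in auto)
          moreover have "(gen(r := kconst c))(m := y) = b(r := kconst c)"
            using lt by (intro ext) (auto simp: b_def)
          then have "poly ?q3 y = 0" using q0 by (simp add: poly_mp_univ[symmetric, of _ b r] poly_mp_univ)
          ultimately have "?q3 = 0" using Cclosed yC by blast
          moreover have "(gen(r := kconst c))(m := gen m) = gen(r := kconst c)" using lt by (intro ext) auto
          ultimately show ?thesis using poly_mp_univ[of kconst "gen(r := kconst c)" m P "gen m"]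
            by (simp add: poly_mp_univ)
        qed
        then have "mp_univ kconst gen r P = 0" by (rule poly_zero_on_kconst)
        then have "mp_eval kconst gen P = 0" using poly_mp_univ[of kconst gen r P "gen r"] by simp
        then show False using P0 by (simp flip: ratfun_of_eq_mp_eval)
      qed
    qed
    then show ?thesis using other rm by (cases "k = r") (auto simp: le_less)
  qed
  have "surj \<tau>"
  proof -
    have R: "ratfun_of p \<in> range \<tau>" for p
      unfolding ratfun_of_eq_mp_eval
      by (rule mp_eval_rel[where R = "\<lambda>a _. a \<in> range \<tau>" and h' = kconst and q = p and y = gen])
         (use Tk Tg rangeI[of \<tau> 0] rangeI[of \<tau> 1] cring_map.hom_zero[OF kc]
           in \<open>auto simp flip: \<tau>.hom_add \<tau>.hom_mult\<close>)
    have "e \<in> range \<tau>" for e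
    proof -
      obtain q where q: "q \<noteq> 0" "poly (map_poly ratfun_of q) e = 0"
        using ratfun_closure_algebraic by blast
      show ?thesis
      proof (rule range_relatively_algebraically_closed[OF \<tau>(1) _ _ q(2)])
        show "coeff (map_poly ratfun_of q) n \<in> range \<tau>" for n
          using R by (simp add: coeff_map_poly)
        show "map_poly ratfun_of q \<noteq> 0" using q(1) by (simp add: map_poly_eq_0_iff)
      qed
    qed
    then show ?thesis by auto
  qed
  then have bij: "bij \<tau>" using cring_map_field_inj[OF \<tau>(1)] by (simp add: bij_def)
  \<comment> \<open>For n < r minimality gives \<open>y\<close> in \<open>C n\<close>, so the
    equation is one for X_n over \<open>C n\<close> and holds identically in that position. Only
    constants are inserted at first, because they lie in every \<open>C n\<close> and so keep the
    induction going.\<close>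
  have early: "mp_eval kconst (\<lambda>i. if i < n then kconst (c i) else b i) P = 0" if "n \<le> r" for n c
    using that
  proof (induction n)
    case 0
    then show ?case using y by (simp add: b_def fun_upd_def)
  next
    case (Suc n)
    let ?b = "\<lambda>i. if i < n then kconst (c i) else b i"
    let ?q = "mp_univ kconst ?b n P"
    have "coeff ?q l \<in> C n" for l
      by (rule Cc[OF kc]) (use Suc.prems Ck Cg rmin in \<open>auto simp: b_def\<close>)
    moreover have "?b(n := gen n) = ?b" using Suc.prems rm by (intro ext) (auto simp: b_def)
    then have "poly ?q (gen n) = 0" using Suc by (simp add: poly_mp_univ)
    ultimately have "?q = 0" using Cclosed Cn by blast
    moreover have "?b(n := kconst (c n)) = (\<lambda>i. if i < Suc n then kconst (c i) else b i)" by auto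
    ultimately show ?case using poly_mp_univ[of kconst ?b n P "kconst (c n)"] by simp
  qed
  \<comment> \<open>The field k is infinite, so an equation valid for all constants in a position
    holds for every element there; positions are freed one at a time.\<close>
  have arbitrary: "mp_eval kconst (\<lambda>i. if i < n then z i else if i < r then kconst (c i) else b i) P = 0"
    if "n \<le> r" for n c z
    using that
  proof (induction n arbitrary: c)
    case 0
    then show ?case using early[of r c] by simp
  next
    case (Suc n)
    let ?b = "\<lambda>i. if i < n then z i else if i < r then kconst (c i) else b i"
    let ?q = "mp_univ kconst ?b n P"
    have "poly ?q (kconst c') = 0" for c'
    proof -
      have "?b(n := kconst c')
          = (\<lambda>i. if i < n then z i else if i < r then kconst ((c(n := c')) i) else b i)"
        using Suc.prems by (intro ext) auto
      then show ?thesis using Suc.IH[of "c(n := c')"] Suc.prems by (simp add: poly_mp_univ)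
    qed
    then have "?q = 0" by (rule poly_zero_on_kconst)
    moreover have "?b(n := z n)
        = (\<lambda>i. if i < Suc n then z i else if i < r then kconst (c i) else b i)"
      by auto
    ultimately show ?case using poly_mp_univ[of kconst ?b n P "z n"] by simp
  qed
  have "surj (\<tau> ^^ r)" using \<open>surj \<tau>\<close> by (rule surj_fn)
  \<comment> \<open>The target is X_r, or \<open>y\<close> itself when r = m. The iterates of
    \<open>x\<close> before position \<open>r\<close> are uncontrolled, which is what
    \<open>arbitrary\<close> allows for.\<close>
  then obtain x where x: "(\<tau> ^^ r) x = b r" by (metis surjD)
  have it: "(\<tau> ^^ (r + d)) x = b (r + d)" if "r + d \<le> m" for d
    using that
  proof (induction d)
    case (Suc d)
    then have "b (r + d) = gen (r + d)" by (auto simp: b_def)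
    then show ?case using Suc \<tau>(3)[of "r + d"] by (simp add: s_def)
  qed (simp add: x)
  \<comment> \<open>The second branch is never reached; it only gives the expression the shape of
    \<open>arbitrary\<close> at n = r.\<close>
  have "mp_eval kconst (\<lambda>j. (\<tau> ^^ j) x) P
      = mp_eval kconst (\<lambda>i. if i < r then (\<tau> ^^ i) x else if i < r then kconst 0 else b i) P"
  proof (rule mp_eval_cong)
    fix i assume "i \<in> mp_vars P"
    then show "(\<tau> ^^ i) x = (if i < r then (\<tau> ^^ i) x else if i < r then kconst 0 else b i)"
      using it[of "i - r"] mle by auto
  qed
  also have "\<dots> = 0" using arbitrary[of r "\<lambda>i. (\<tau> ^^ i) x" "\<lambda>_. 0"] by simp
  finally show ?thesis using that \<tau>(1,2) bij by blast
qed

text \<open>The equation becomes a one-element system in the unknown 0, with X_j renamed to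
  \<open>(0, j)\<close>. The extension lives in a type of its own, so existential closedness enters
  through \<open>acfa_arbitrary_extension\<close>.\<close>

lemma acfa_poly_root:
  fixes \<sigma> :: "'k::field_char_0 \<Rightarrow> 'k" and P :: "(nat, 'k) mpol"
  assumes "acfa \<sigma>" and ne: "mp_vars P \<noteq> {}"
  shows "\<exists>x. mp_eval (\<lambda>c. c) (\<lambda>j. (\<sigma> ^^ j) x) P = 0"
proof -
  have \<sigma>: "field_automorphism \<sigma>" using assms by (simp add: acfa_def)
  obtain \<tau> :: "'k ratfun_closure \<Rightarrow> 'k ratfun_closure" and x
    where \<tau>: "cring_map \<tau>" "bij \<tau>" "\<And>c. \<tau> (kconst c) = kconst (\<sigma> c)"
      and x: "mp_eval kconst (\<lambda>j. (\<tau> ^^ j) x) P = 0"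
    using difference_poly_root_in_extension[OF \<sigma> ne] by blast
  let ?L = "ring_of_type_algebra :: 'k ratfun_closure ring"
  define Q :: "'k difference_poly" where "Q = mp_eval mp_const (\<lambda>j. mp_var (0, j)) P"
  have "difference_field_extension \<sigma> ?L \<tau> kconst"
    unfolding difference_field_extension_def ring_iso_def
    using field_from_type_algebra \<tau> cring_map_kconst
    by (auto simp: ring_hom_def ring_of_type_algebra_def cring_map_def bij_def)
  moreover have Q: "mp_eval h (\<lambda>ij. (f ^^ snd ij) (a (fst ij))) Q = mp_eval h (\<lambda>j. (f ^^ j) (a 0)) P"
    if h: "cring_map h" for h :: "'k \<Rightarrow> 'l::field" and f a
    unfolding Q_def
    by (simp add: cring_map.hom_mp_eval[OF cring_map.mp_eval_hom[OF h]] cring_map.mp_eval_const[OF h]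
        cring_map.mp_eval_var[OF h])
  have "system_solvable_in ?L \<tau> kconst {Q}"
    unfolding system_solvable_in_def difference_poly_eval_type
    using x by (intro exI[of _ "\<lambda>_. x"]) (simp add: Q[OF cring_map_kconst, of \<tau> "\<lambda>_. x"] ring_of_type_algebra_def)
  ultimately have "system_solvable_in ring_of_type_algebra \<sigma> id {Q}"
    using acfa_arbitrary_extension[OF \<open>acfa \<sigma>\<close>, of "{Q}"] by blast
  then show ?thesis
    unfolding system_solvable_in_def difference_poly_eval_type id_def
    by (auto simp: Q[OF cring_map_id] ring_of_type_algebra_def)
qed

section \<open>Difference polynomials in one variable over the valued field\<close>

definition diff_eval :: "('a::comm_ring_1 \<Rightarrow> 'a) \<Rightarrow> (nat, 'a) mpol \<Rightarrow> 'a \<Rightarrow> 'a" where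
  "diff_eval \<sigma> p a = mp_eval (\<lambda>c. c) (\<lambda>j. (\<sigma> ^^ j) a) p"

text \<open>The difference polynomial \<open>p(a + d x)\<close>.\<close>

definition shift :: "('a::comm_ring_1 \<Rightarrow> 'a) \<Rightarrow> 'a \<Rightarrow> 'a \<Rightarrow> (nat, 'a) mpol \<Rightarrow> (nat, 'a) mpol" where
  "shift \<sigma> a d = mp_eval mp_const (\<lambda>j. mp_const ((\<sigma> ^^ j) a) + mp_const ((\<sigma> ^^ j) d) * mp_var j)"

lemma lookup_mp_const_mult:
  "Poly_Mapping.lookup (mp_const c * p) e = c * Poly_Mapping.lookup p e"
  by (induction p rule: mpol_induct)
     (auto simp: mp_const_def mult_single lookup_add lookup_single when_def algebra_simps)

lemma lookup_zero_eq_mp_eval: "Poly_Mapping.lookup p 0 = mp_eval (\<lambda>c. c) (\<lambda>_. 0) p"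
proof -
  have "mono_eval (\<lambda>_. 0 :: 'a) e = (if e = 0 then 1 else 0)" for e :: "'b \<Rightarrow>\<^sub>0 nat"
  proof (cases "e = 0")
    case False
    then obtain v where "Poly_Mapping.lookup e v \<noteq> 0" by (metis poly_mapping_eqI lookup_zero)
    then have "v \<in> Poly_Mapping.keys e" "(0 :: 'a) ^ Poly_Mapping.lookup e v = 0"
      by (auto simp: in_keys_iff power_0_left)
    then have "(\<Prod>v\<in>Poly_Mapping.keys e. (0 :: 'a) ^ Poly_Mapping.lookup e v) = 0"
      by (intro prod_zero) auto
    then show ?thesis using False by (simp add: mono_eval_def)
  qed simp
  then show ?thesis
    by (simp add: mp_eval_def if_distrib[of "(*) _"] sum.delta' in_keys_iff cong: if_cong)
qed

lemma mp_vars_empty_imp_const: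
  assumes "mp_vars p = {}" shows "p = mp_const (Poly_Mapping.lookup p 0)"
proof (rule poly_mapping_eqI)
  fix e
  have "Poly_Mapping.lookup p e = 0" if "e \<noteq> 0"
  proof (rule ccontr)
    assume "Poly_Mapping.lookup p e \<noteq> 0"
    then have "Poly_Mapping.keys e = {}" using assms by (auto simp: mp_vars_def in_keys_iff)
    then show False using that keys_eq_empty[of e] by (metis poly_mapping_eqI lookup_zero empty_iff in_keys_iff)
  qed
  then show "Poly_Mapping.lookup p e = Poly_Mapping.lookup (mp_const (Poly_Mapping.lookup p 0)) e"
    by (auto simp: mp_const_def lookup_single when_def)
qed

lemma mp_vars_nonempty:
  fixes p :: "('v, 'a::comm_ring_1) mpol"
  assumes "Poly_Mapping.lookup p e \<noteq> 0" "e \<noteq> 0" shows "mp_vars p \<noteq> {}"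
proof
  assume "mp_vars p = {}"
  then have "Poly_Mapping.lookup p e = Poly_Mapping.lookup (mp_const (Poly_Mapping.lookup p 0)) e"
    using mp_vars_empty_imp_const by metis
  then show False using assms by (simp add: mp_const_def lookup_single when_def)
qed

lemma mp_vars_nonempty_imp:
  assumes "mp_vars p \<noteq> {}" obtains e where "Poly_Mapping.lookup p e \<noteq> 0" "e \<noteq> 0"
  using assms by (auto simp: mp_vars_def in_keys_iff)

context
  fixes \<sigma> :: "'a::comm_ring_1 \<Rightarrow> 'a"
  assumes \<sigma>: "cring_map \<sigma>"
begin

interpretation \<sigma>: cring_map \<sigma> by (rule \<sigma>)
interpretation \<sigma>n: cring_map "\<sigma> ^^ n" for n by (rule cring_map_funpow[OF \<sigma>])
interpretation C: cring_map "mp_const :: 'a \<Rightarrow> (nat, 'a) mpol" by (rule cring_map_mp_const)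
interpretation E: cring_map "mp_eval mp_const x :: (nat, 'a) mpol \<Rightarrow> (nat, 'a) mpol" for x
  by (rule C.mp_eval_hom)
interpretation D: cring_map "\<lambda>p. diff_eval \<sigma> p a" for a
  unfolding diff_eval_def by (rule cring_map.mp_eval_hom[OF cring_map_id])

lemma diff_eval_simps: "diff_eval \<sigma> (mp_const c) a = c" "diff_eval \<sigma> (mp_var j) a = (\<sigma> ^^ j) a"
  by (simp_all add: diff_eval_def cring_map.mp_eval_const[OF cring_map_id]
      cring_map.mp_eval_var[OF cring_map_id])

lemma diff_eval_shift: "diff_eval \<sigma> (shift \<sigma> a d p) z = diff_eval \<sigma> p (a + d * z)"
  unfolding shift_def D.hom_mp_eval by (simp add: diff_eval_simps) (simp add: diff_eval_def)

lemma shift_shift: "shift \<sigma> x e (shift \<sigma> a d p) = shift \<sigma> (a + d * x) (d * e) p"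
  unfolding shift_def E.hom_mp_eval by (simp add: algebra_simps)

lemma shift_const_mult: "shift \<sigma> a d (mp_const c * p) = mp_const c * shift \<sigma> a d p"
  by (simp add: shift_def)

lemma shift_const: "shift \<sigma> a d (mp_const c) = mp_const c"
  by (simp add: shift_def)

lemma shift_zero_one: "shift \<sigma> 0 1 p = p"
  by (simp add: shift_def mp_eval_self)

lemma lookup_shift_zero: "Poly_Mapping.lookup (shift \<sigma> a d p) 0 = diff_eval \<sigma> p a"
  using diff_eval_shift[of a d p 0] by (simp add: lookup_zero_eq_mp_eval diff_eval_def)

lemma lookup_scale:
  "Poly_Mapping.lookup (shift \<sigma> 0 d p) e
     = Poly_Mapping.lookup p e * mono_eval (\<lambda>j. (\<sigma> ^^ j) d) e"
proof (induction p rule: mpol_induct)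
  case (add p q)
  then show ?case unfolding shift_def E.hom_add by (simp add: lookup_add algebra_simps)
next
  case (single u c)
  have "mono_eval (\<lambda>j. mp_const ((\<sigma> ^^ j) d) * mp_var j) u
      = (mp_const (mono_eval (\<lambda>j. (\<sigma> ^^ j) d) u) * mono_eval mp_var u :: (nat, 'a) mpol)"
    by (simp add: mono_eval_def power_mult_distrib prod.distrib C.hom_prod)
  moreover have "mono_eval mp_var u = (Poly_Mapping.single u 1 :: (nat, 'a) mpol)"
    using mp_eval_self[of "Poly_Mapping.single u (1 :: 'a)"] by (simp add: mp_eval_single)
  ultimately show ?case
    by (simp add: shift_def mp_eval_single lookup_mp_const_mult lookup_single when_def)
qed

lemma lookup_shift:
  "Poly_Mapping.lookup (shift \<sigma> a d p) e
     = Poly_Mapping.lookup (shift \<sigma> a 1 p) e * mono_eval (\<lambda>j. (\<sigma> ^^ j) d) e"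
  using lookup_scale[of d "shift \<sigma> a 1 p" e] by (simp add: shift_shift)

text \<open>Translating back by \<open>- a\<close> would otherwise make \<open>p\<close>
  constant.\<close>

lemma mp_vars_shift_nonempty:
  assumes "mp_vars p \<noteq> {}" shows "mp_vars (shift \<sigma> a 1 p) \<noteq> {}"
proof
  assume "mp_vars (shift \<sigma> a 1 p) = {}"
  then obtain c where "shift \<sigma> a 1 p = mp_const c" using mp_vars_empty_imp_const by blast
  then have "shift \<sigma> (- a) 1 (shift \<sigma> a 1 p) = mp_const c" by (simp add: shift_const)
  then have "p = mp_const c" by (simp add: shift_shift shift_zero_one)
  then show False using assms by (simp add: mp_vars_const)
qed

end

locale acfa_valued_field =
  fixes v :: "'a::field_char_0 \<Rightarrow> real"
    and \<sigma> :: "'a \<Rightarrow> 'a"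
    and \<rho> :: real
    and res :: "'a \<Rightarrow> 'k::field_char_0"
    and \<sigma>' :: "'k \<Rightarrow> 'k"
    and t :: "real \<Rightarrow> 'a"
  assumes vdf: "valued_difference_field v \<sigma>"
    and mult: "multiplicative_with_exponent v \<sigma> \<rho>"
    and sph: "spherically_complete v"
    and rmap: "residue_map v res"
    and induced: "induced_on_residues v res \<sigma> \<sigma>'"
    and acfa: "acfa \<sigma>'"
    and divisible: "\<forall>q\<in>rat_adjoin \<rho>. \<forall>\<gamma>\<in>value_group v. q * \<gamma> \<in> value_group v"
    and splitting: "compatible_splitting v \<sigma> \<rho> t"
begin

section \<open>Valuation, residues and value group\<close>

abbreviation \<O> where "\<O> \<equiv> valuation_ring v"
abbreviation \<Gamma> where "\<Gamma> \<equiv> value_group v"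

lemma v_mult: "x \<noteq> 0 \<Longrightarrow> y \<noteq> 0 \<Longrightarrow> v (x * y) = v x + v y"
  using vdf by (simp add: valued_difference_field_def valuation_def)

lemma v_add: "x \<noteq> 0 \<Longrightarrow> y \<noteq> 0 \<Longrightarrow> x + y \<noteq> 0 \<Longrightarrow> min (v x) (v y) \<le> v (x + y)"
  using vdf by (simp add: valued_difference_field_def valuation_def)

lemma v_one [simp]: "v 1 = 0"
  using v_mult[of 1 1] by simp

lemma v_inverse: "x \<noteq> 0 \<Longrightarrow> v (inverse x) = - v x"
  using v_mult[of x "inverse x"] by simp

lemma v_divide: "x \<noteq> 0 \<Longrightarrow> y \<noteq> 0 \<Longrightarrow> v (x / y) = v x - v y"
  by (simp add: divide_inverse v_mult v_inverse)

lemma v_power: "x \<noteq> 0 \<Longrightarrow> v (x ^ n) = real n * v x"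
  by (induction n) (auto simp: v_mult algebra_simps)

lemma v_prod: "(\<And>i. i \<in> A \<Longrightarrow> f i \<noteq> 0) \<Longrightarrow> v (prod f A) = (\<Sum>i\<in>A. v (f i))"
  by (induction A rule: infinite_finite_induct) (auto simp: v_mult)

lemma \<rho>_pos: "0 < \<rho>"
  using mult by (simp add: multiplicative_with_exponent_def)

lemma cring_map_\<sigma>: "cring_map \<sigma>"
  by (rule field_automorphism_cring_map) (use vdf in \<open>simp add: valued_difference_field_def\<close>)

lemma cring_map_\<sigma>': "cring_map \<sigma>'"
  by (rule field_automorphism_cring_map) (use acfa in \<open>simp add: acfa_def\<close>)

sublocale \<sigma>: cring_map \<sigma> by (rule cring_map_\<sigma>)
sublocale \<sigma>n: cring_map "\<sigma> ^^ n" for n by (rule cring_map_funpow[OF cring_map_\<sigma>])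

lemma \<sigma>n_eq_0_iff [simp]: "(\<sigma> ^^ n) x = 0 \<longleftrightarrow> x = 0"
  using cring_map_field_inj[OF \<sigma>n.cring_map_axioms, of n] by (metis \<sigma>n.hom_zero injD)

lemma v_\<sigma>n: "x \<noteq> 0 \<Longrightarrow> v ((\<sigma> ^^ n) x) = \<rho> ^ n * v x"
proof (induction n)
  case (Suc n)
  then show ?case using mult by (simp add: multiplicative_with_exponent_def)
qed simp

lemma \<O>_iff: "x \<in> \<O> \<longleftrightarrow> x = 0 \<or> 0 \<le> v x"
  by (simp add: valuation_ring_def)

lemma \<O>_closed:
  "0 \<in> \<O>" "1 \<in> \<O>"
  "x \<in> \<O> \<Longrightarrow> y \<in> \<O> \<Longrightarrow> x + y \<in> \<O>"
  "x \<in> \<O> \<Longrightarrow> y \<in> \<O> \<Longrightarrow> x * y \<in> \<O>"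
proof -
  assume "x \<in> \<O>" "y \<in> \<O>"
  then show "x + y \<in> \<O>" using v_add[of x y] by (cases "x = 0 \<or> y = 0 \<or> x + y = 0") (auto simp: \<O>_iff)
  show "x * y \<in> \<O>" using v_mult[of x y] \<open>x \<in> \<O>\<close> \<open>y \<in> \<O>\<close>
    by (cases "x * y = 0") (auto simp: \<O>_iff)
qed (auto simp: \<O>_iff)

lemma \<O>_\<sigma>: "x \<in> \<O> \<Longrightarrow> \<sigma> x \<in> \<O>"
  using vdf by (auto simp: valued_difference_field_def)

lemma \<O>_\<sigma>n: "x \<in> \<O> \<Longrightarrow> (\<sigma> ^^ n) x \<in> \<O>"
  by (induction n) (auto intro: \<O>_\<sigma>)

lemma res_simps:
  "res 1 = 1"
  "x \<in> \<O> \<Longrightarrow> y \<in> \<O> \<Longrightarrow> res (x + y) = res x + res y"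
  "x \<in> \<O> \<Longrightarrow> y \<in> \<O> \<Longrightarrow> res (x * y) = res x * res y"
  using rmap by (simp_all add: residue_map_def)

lemma res_eq_0_iff: "x \<in> \<O> \<Longrightarrow> res x = 0 \<longleftrightarrow> x = 0 \<or> 0 < v x"
  using rmap by (simp add: residue_map_def valuation_ideal_def)

lemma res_zero [simp]: "res 0 = 0"
  using res_eq_0_iff \<O>_closed(1) by blast

lemma res_surj: obtains x where "x \<in> \<O>" "res x = c"
  using rmap unfolding residue_map_def by (metis UNIV_I imageE)

lemma res_\<sigma>n: "x \<in> \<O> \<Longrightarrow> res ((\<sigma> ^^ n) x) = (\<sigma>' ^^ n) (res x)"
proof (induction n)
  case (Suc n)
  moreover have "\<sigma>' (res ((\<sigma> ^^ n) x)) = res (\<sigma> ((\<sigma> ^^ n) x))"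
    using induced \<O>_\<sigma>n[OF Suc.prems] by (simp add: induced_on_residues_def)
  ultimately show ?case by simp
qed simp

lemma \<Gamma>_v: "x \<noteq> 0 \<Longrightarrow> v x \<in> \<Gamma>"
  by (simp add: value_group_def)

lemma \<Gamma>_add: "\<gamma> \<in> \<Gamma> \<Longrightarrow> \<delta> \<in> \<Gamma> \<Longrightarrow> \<gamma> + \<delta> \<in> \<Gamma>"
proof -
  assume "\<gamma> \<in> \<Gamma>" "\<delta> \<in> \<Gamma>"
  then obtain x y where "x \<noteq> 0" "\<gamma> = v x" "y \<noteq> 0" "\<delta> = v y" by (auto simp: value_group_def)
  then show "\<gamma> + \<delta> \<in> \<Gamma>" using \<Gamma>_v[of "x * y"] by (simp add: v_mult)
qed

lemma \<Gamma>_minus: "\<gamma> \<in> \<Gamma> \<Longrightarrow> - \<gamma> \<in> \<Gamma>"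
proof -
  assume "\<gamma> \<in> \<Gamma>"
  then obtain x where "x \<noteq> 0" "\<gamma> = v x" by (auto simp: value_group_def)
  then show "- \<gamma> \<in> \<Gamma>" using \<Gamma>_v[of "inverse x"] by (simp add: v_inverse)
qed

lemma \<Gamma>_diff: "\<gamma> \<in> \<Gamma> \<Longrightarrow> \<delta> \<in> \<Gamma> \<Longrightarrow> \<gamma> - \<delta> \<in> \<Gamma>"
  using \<Gamma>_add[of \<gamma> "- \<delta>"] \<Gamma>_minus by simp

lemma t_nonzero: "\<gamma> \<in> \<Gamma> \<Longrightarrow> t \<gamma> \<noteq> 0"
  and v_t: "\<gamma> \<in> \<Gamma> \<Longrightarrow> v (t \<gamma>) = \<gamma>"
  using splitting by (auto simp: compatible_splitting_def)

text \<open>The exponent, read as a polynomial in \<sigma>, evaluated at \<rho>: the factor by which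
  the monomial multiplies valuations.\<close>

definition wt :: "(nat \<Rightarrow>\<^sub>0 nat) \<Rightarrow> real" where
  "wt e = (\<Sum>j\<in>Poly_Mapping.keys e. real (Poly_Mapping.lookup e j) * \<rho> ^ j)"

lemma wt_pos: "e \<noteq> 0 \<Longrightarrow> 0 < wt e"
  unfolding wt_def
proof (rule sum_pos)
  assume "e \<noteq> 0"
  then show "Poly_Mapping.keys e \<noteq> {}"
    by (metis poly_mapping_eqI lookup_zero empty_iff in_keys_iff)
qed (use \<rho>_pos in \<open>auto simp: in_keys_iff\<close>)

lemma mono_eval_nonzero: "x \<noteq> 0 \<Longrightarrow> mono_eval (\<lambda>j. (\<sigma> ^^ j) x) e \<noteq> 0"
  by (simp add: mono_eval_def)

lemma v_mono_eval: "x \<noteq> 0 \<Longrightarrow> v (mono_eval (\<lambda>j. (\<sigma> ^^ j) x) e) = wt e * v x"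
  by (simp add: mono_eval_def wt_def v_prod v_power v_\<sigma>n sum_distrib_right mult.assoc)

text \<open>Here the module structure over Q(\<rho>) enters: \<open>wt e\<close> is the value at
  \<rho> of a rational polynomial, nonzero because it is positive.\<close>

lemma \<Gamma>_divide_wt:
  assumes "\<gamma> \<in> \<Gamma>" "e \<noteq> 0" shows "\<gamma> / wt e \<in> \<Gamma>"
proof -
  define q :: "rat poly" where
    "q = (\<Sum>j\<in>Poly_Mapping.keys e. monom (of_nat (Poly_Mapping.lookup e j)) j)"
  have add: "map_poly of_rat (p + r) = map_poly of_rat p + (map_poly of_rat r :: real poly)" for p r
    by (rule poly_eqI) (simp add: coeff_map_poly of_rat_add)
  have "poly (map_poly of_rat (\<Sum>j\<in>A. monom (of_nat (f j)) j)) \<rho> = (\<Sum>j\<in>A. real (f j) * \<rho> ^ j)" for A f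
    by (induction A rule: infinite_finite_induct) (auto simp: add map_poly_monom poly_monom)
  then have q: "poly (map_poly of_rat q) \<rho> = wt e" by (simp add: q_def wt_def)
  then have "1 / wt e \<in> rat_adjoin \<rho>"
    unfolding rat_adjoin_def using wt_pos[OF assms(2)]
    by (intro CollectI exI[of _ 1] exI[of _ q]) simp
  then show ?thesis using divisible assms(1) by fastforce
qed

text \<open>A relation rather than a function, with integrality built in, so that
  \<open>mp_eval_rel\<close> carries it through substitutions.\<close>

definition reduces :: "('v, 'a) mpol \<Rightarrow> ('v, 'k) mpol \<Rightarrow> bool" where
  "reduces p q \<longleftrightarrow> (\<forall>e. Poly_Mapping.lookup p e \<in> \<O> \<and> res (Poly_Mapping.lookup p e) = Poly_Mapping.lookup q e)"

lemma reduces_add: "reduces p p' \<Longrightarrow> reduces q q' \<Longrightarrow> reduces (p + q) (p' + q')"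
  by (simp add: reduces_def lookup_add \<O>_closed res_simps)

lemma reduces_single: "c \<in> \<O> \<Longrightarrow> res c = d \<Longrightarrow> reduces (Poly_Mapping.single e c) (Poly_Mapping.single e d)"
  by (auto simp: reduces_def lookup_single when_def \<O>_closed)

lemma reduces_zero: "reduces 0 0"
  by (simp add: reduces_def \<O>_closed)

lemma reduces_sum: "(\<And>i. i \<in> A \<Longrightarrow> reduces (f i) (g i)) \<Longrightarrow> reduces (sum f A) (sum g A)"
  by (induction A rule: infinite_finite_induct) (auto intro: reduces_zero reduces_add)

lemma reduces_mult:
  assumes "reduces p p'" "reduces q q'" shows "reduces (p * q) (p' * q')"
proof -
  \<comment> \<open>Both \<open>p\<close> and its reduction are expanded over the keys of
    \<open>p\<close>, since terms with residue zero disappear from the reduction.\<close>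
  have ex: "p = (\<Sum>e\<in>Poly_Mapping.keys p. Poly_Mapping.single e (Poly_Mapping.lookup p e))
     \<and> p' = (\<Sum>e\<in>Poly_Mapping.keys p. Poly_Mapping.single e (Poly_Mapping.lookup p' e))"
    if "reduces p p'" for p :: "('b, 'a) mpol" and p'
  proof -
    have "Poly_Mapping.lookup p' e = 0" if "Poly_Mapping.lookup p e = 0" for e
      using \<open>reduces p p'\<close> that res_zero unfolding reduces_def by metis
    then show ?thesis
      by (auto intro!: poly_mapping_eqI simp: lookup_sum lookup_single when_def in_keys_iff)
  qed
  have "p * q = (\<Sum>e\<in>Poly_Mapping.keys p. \<Sum>d\<in>Poly_Mapping.keys q.
      Poly_Mapping.single (e + d) (Poly_Mapping.lookup p e * Poly_Mapping.lookup q d))"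
    by (subst ex[OF assms(1), THEN conjunct1], subst ex[OF assms(2), THEN conjunct1])
       (simp add: sum_product mult_single)
  moreover have "p' * q' = (\<Sum>e\<in>Poly_Mapping.keys p. \<Sum>d\<in>Poly_Mapping.keys q.
      Poly_Mapping.single (e + d) (Poly_Mapping.lookup p' e * Poly_Mapping.lookup q' d))"
    by (subst ex[OF assms(1), THEN conjunct2], subst ex[OF assms(2), THEN conjunct2])
       (simp add: sum_product mult_single)
  moreover have "reduces (Poly_Mapping.single (e + d) (Poly_Mapping.lookup p e * Poly_Mapping.lookup q d))
      (Poly_Mapping.single (e + d) (Poly_Mapping.lookup p' e * Poly_Mapping.lookup q' d))" for e d
    using assms by (intro reduces_single) (simp_all add: reduces_def \<O>_closed res_simps)
  ultimately show ?thesis by (simp only: reduces_sum)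
qed

lemma reduces_const: "c \<in> \<O> \<Longrightarrow> reduces (mp_const c) (mp_const (res c))"
  unfolding mp_const_def by (rule reduces_single) auto

lemma reduces_var: "reduces (mp_var i) (mp_var i)"
  unfolding mp_var_def by (rule reduces_single) (auto simp: \<O>_closed res_simps)

lemma reduces_mp_eval:
  assumes "reduces p q" "\<And>i. i \<in> mp_vars p \<union> mp_vars q \<Longrightarrow> reduces (x i) (y i)"
  shows "reduces (mp_eval mp_const x p) (mp_eval mp_const y q)"
proof (rule mp_eval_rel[where R = reduces])
  show "reduces 1 1" using reduces_single[of 1 1 0] by (simp add: \<O>_closed res_simps)
  show "reduces (mp_const (Poly_Mapping.lookup p e)) (mp_const (Poly_Mapping.lookup q e))" for e
    using assms(1) reduces_const unfolding reduces_def by metis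
qed (use assms reduces_zero reduces_add reduces_mult
      cring_map.hom_zero[OF cring_map_mp_const] in auto)

lemma reduces_shift:
  assumes "reduces p q" "a \<in> \<O>" shows "reduces (shift \<sigma> a 1 p) (shift \<sigma>' (res a) 1 q)"
  unfolding shift_def
proof (rule reduces_mp_eval[OF assms(1)])
  fix j
  have "(\<sigma>' ^^ j) 1 = 1"
    by (rule cring_map.hom_one[OF cring_map_funpow[OF cring_map_\<sigma>']])
  then show "reduces (mp_const ((\<sigma> ^^ j) a) + mp_const ((\<sigma> ^^ j) 1) * mp_var j)
       (mp_const ((\<sigma>' ^^ j) (res a)) + mp_const ((\<sigma>' ^^ j) 1) * mp_var j)"
    using reduces_add[OF reduces_const[OF \<O>_\<sigma>n[OF assms(2)]] reduces_var] assms(2)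
    by (simp add: cring_map.hom_one[OF cring_map_mp_const] res_\<sigma>n)
qed

section \<open>Critical radii and the Newton iteration\<close>

text \<open>The radius \<open>\<gamma>\<close> makes the Taylor expansion \<open>p(a + t\<^bsup>\<gamma>\<^esup> x) / p(a)\<close> integral with nonconstant
  reduction.\<close>

definition critical_radius :: "(nat, 'a) mpol \<Rightarrow> 'a \<Rightarrow> real \<Rightarrow> bool" where
  "critical_radius p a \<gamma> \<longleftrightarrow> \<gamma> \<in> \<Gamma> \<and> diff_eval \<sigma> p a \<noteq> 0 \<and>
     (\<forall>e. e \<noteq> 0 \<longrightarrow> Poly_Mapping.lookup (shift \<sigma> a 1 p) e \<noteq> 0 \<longrightarrow>
        v (diff_eval \<sigma> p a) \<le> v (Poly_Mapping.lookup (shift \<sigma> a 1 p) e) + wt e * \<gamma>) \<and>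
     (\<exists>e. e \<noteq> 0 \<and> Poly_Mapping.lookup (shift \<sigma> a 1 p) e \<noteq> 0 \<and>
        v (diff_eval \<sigma> p a) = v (Poly_Mapping.lookup (shift \<sigma> a 1 p) e) + wt e * \<gamma>)"

text \<open>A Newton polygon slope: each nonconstant term ties with p(a) at one radius, and the
  largest of these radii is the one at which no term falls below v(p(a)).\<close>

lemma critical_radius_exists:
  assumes "diff_eval \<sigma> p a \<noteq> 0" "e \<noteq> 0" "Poly_Mapping.lookup (shift \<sigma> a 1 p) e \<noteq> 0"
  shows "\<exists>\<gamma>. critical_radius p a \<gamma>"
proof -
  let ?A = "Poly_Mapping.lookup (shift \<sigma> a 1 p)" and ?g = "v (diff_eval \<sigma> p a)"
  let ?K = "Poly_Mapping.keys (shift \<sigma> a 1 p) - {0}"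
  define f where "f e = (?g - v (?A e)) / wt e" for e
  have ne: "f ` ?K \<noteq> {}" and fin: "finite (f ` ?K)" using assms by (auto simp: in_keys_iff)
  obtain u where u: "u \<in> ?K" "Max (f ` ?K) = f u" using Max_in[OF fin ne] by auto
  have "f u \<in> \<Gamma>"
    unfolding f_def using u(1) assms(1) by (intro \<Gamma>_divide_wt \<Gamma>_diff \<Gamma>_v) (auto simp: in_keys_iff)
  moreover have "?g \<le> v (?A e) + wt e * f u" if "e \<noteq> 0" "?A e \<noteq> 0" for e
  proof -
    have "f e \<le> f u" using that Max_ge[OF fin, of "f e"] u(2) by (auto simp: in_keys_iff)
    then have "wt e * f e \<le> wt e * f u" using wt_pos[OF that(1)] by simp
    then show ?thesis using wt_pos[OF that(1)] by (simp add: f_def)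
  qed
  moreover have "?g = v (?A u) + wt u * f u" using wt_pos[of u] u(1) by (simp add: f_def)
  ultimately show ?thesis
    using assms(1) u(1) unfolding critical_radius_def by (intro exI[of _ "f u"]) (auto simp: in_keys_iff)
qed

text \<open>Division by p(a) makes the constant coefficient 1; the inequalities make the others
  integral and the equality makes one of them a unit.\<close>

lemma critical_radius_reduction:
  assumes c: "critical_radius p a \<gamma>"
  obtains q where "reduces (mp_const (inverse (diff_eval \<sigma> p a)) * shift \<sigma> a (t \<gamma>) p) q"
    "mp_vars q \<noteq> {}"
proof -
  let ?A = "Poly_Mapping.lookup (shift \<sigma> a 1 p)" and ?g = "diff_eval \<sigma> p a"
  let ?Q = "mp_const (inverse ?g) * shift \<sigma> a (t \<gamma>) p"
  have \<gamma>: "\<gamma> \<in> \<Gamma>" "?g \<noteq> 0" using c by (auto simp: critical_radius_def)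
  have look: "Poly_Mapping.lookup ?Q e = inverse ?g * (?A e * mono_eval (\<lambda>j. (\<sigma> ^^ j) (t \<gamma>)) e)" for e
    by (simp add: lookup_mp_const_mult lookup_shift[OF cring_map_\<sigma>, of a "t \<gamma>"])
  have nz: "Poly_Mapping.lookup ?Q e = 0 \<longleftrightarrow> ?A e = 0" for e
    using \<gamma> t_nonzero by (simp add: look mono_eval_nonzero)
  have vQ: "v (Poly_Mapping.lookup ?Q e) = v (?A e) + wt e * \<gamma> - v ?g" if "?A e \<noteq> 0" for e
    using that \<gamma> t_nonzero by (simp add: look v_mult v_inverse mono_eval_nonzero v_mono_eval v_t)
  have O: "Poly_Mapping.lookup ?Q e \<in> \<O>" for e
  proof (cases "e = 0")
    case True
    then show ?thesis
      using \<gamma>(2) by (simp add: lookup_mp_const_mult lookup_shift_zero[OF cring_map_\<sigma>] \<O>_closed)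
  next
    case False
    then show ?thesis using c nz[of e] vQ[of e] by (auto simp: \<O>_iff critical_radius_def)
  qed
  define q where "q = Poly_Mapping.map res ?Q"
  have red: "reduces ?Q q"
    using O by (auto simp: reduces_def q_def Poly_Mapping.map.rep_eq when_def)
  obtain e where e: "e \<noteq> 0" "?A e \<noteq> 0" "v ?g = v (?A e) + wt e * \<gamma>"
    using c by (auto simp: critical_radius_def)
  then have "res (Poly_Mapping.lookup ?Q e) \<noteq> 0"
    using O[of e] nz[of e] vQ[of e] by (simp add: res_eq_0_iff)
  then have "Poly_Mapping.lookup q e \<noteq> 0" using red by (simp add: reduces_def)
  then show ?thesis using that red mp_vars_nonempty e(1) by blast
qed

lemma closed_vball_iff:
  assumes "\<gamma> \<in> \<Gamma>" shows "a' \<in> closed_vball v a \<gamma> \<longleftrightarrow> (\<exists>x\<in>\<O>. a' = a + t \<gamma> * x)"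
proof
  assume a: "a' \<in> closed_vball v a \<gamma>"
  have "(a' - a) / t \<gamma> \<in> \<O>"
    using a t_nonzero[OF assms] by (cases "a' = a") (auto simp: closed_vball_def \<O>_iff v_divide v_t assms)
  then show "\<exists>x\<in>\<O>. a' = a + t \<gamma> * x"
    using t_nonzero[OF assms] by (intro bexI) auto
next
  assume "\<exists>x\<in>\<O>. a' = a + t \<gamma> * x"
  then obtain x where "x \<in> \<O>" "a' = a + t \<gamma> * x" by blast
  then show "a' \<in> closed_vball v a \<gamma>"
    using t_nonzero[OF assms]
    by (cases "x = 0") (auto simp: closed_vball_def \<O>_iff v_mult v_t assms)
qed

text \<open>Recentring at \<open>a'\<close> translates the reduction, which stays nonconstant, so
  some exponent \<open>e\<close> still ties with p(a) at radius \<gamma>. Comparing this with the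
  inequality for \<open>\<gamma>'\<close> gives v(p(a')) - v(p(a)) \<le>
  \<open>wt e * (\<gamma>' - \<gamma>)\<close>, and the left side is nonnegative by
  integrality.\<close>

lemma critical_radius_in_ball:
  assumes c: "critical_radius p a \<gamma>" and a': "a' \<in> closed_vball v a \<gamma>" and nz: "diff_eval \<sigma> p a' \<noteq> 0"
  obtains \<gamma>' where "critical_radius p a' \<gamma>'" "\<gamma> \<le> \<gamma>'"
    "v (diff_eval \<sigma> p a) < v (diff_eval \<sigma> p a') \<Longrightarrow> \<gamma> < \<gamma>'"
proof -
  let ?g = "diff_eval \<sigma> p a" and ?g' = "diff_eval \<sigma> p a'" and ?A = "Poly_Mapping.lookup (shift \<sigma> a' 1 p)"
  have \<gamma>: "\<gamma> \<in> \<Gamma>" "?g \<noteq> 0" using c by (auto simp: critical_radius_def)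
  obtain x where x: "x \<in> \<O>" "a' = a + t \<gamma> * x" using a' closed_vball_iff[OF \<gamma>(1)] by blast
  obtain q where q: "reduces (mp_const (inverse ?g) * shift \<sigma> a (t \<gamma>) p) q" "mp_vars q \<noteq> {}"
    using critical_radius_reduction[OF c] by blast
  let ?Q = "mp_const (inverse ?g) * shift \<sigma> a' (t \<gamma>) p" and ?q = "shift \<sigma>' (res x) 1 q"
  have red: "reduces ?Q ?q"
    using reduces_shift[OF q(1) x(1)]
    by (simp add: shift_const_mult[OF cring_map_\<sigma>] shift_shift[OF cring_map_\<sigma>] x(2))
  have "mp_vars ?q \<noteq> {}" by (rule mp_vars_shift_nonempty[OF cring_map_\<sigma>' q(2)])
  then obtain e where e: "Poly_Mapping.lookup ?q e \<noteq> 0" "e \<noteq> 0" by (rule mp_vars_nonempty_imp)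
  have look: "Poly_Mapping.lookup ?Q e = inverse ?g * (?A e * mono_eval (\<lambda>j. (\<sigma> ^^ j) (t \<gamma>)) e)"
    by (simp add: lookup_mp_const_mult lookup_shift[OF cring_map_\<sigma>, of a' "t \<gamma>"])
  have r: "Poly_Mapping.lookup ?Q e \<in> \<O>" "res (Poly_Mapping.lookup ?Q e) \<noteq> 0"
    using red e(1) by (auto simp: reduces_def)
  then have Q0: "Poly_Mapping.lookup ?Q e \<noteq> 0" by auto
  then have A0: "?A e \<noteq> 0" by (auto simp: look)
  have "v (Poly_Mapping.lookup ?Q e) = 0" using r Q0 res_eq_0_iff[OF r(1)] by (auto simp: \<O>_iff)
  then have eq: "v ?g = v (?A e) + wt e * \<gamma>"
    using A0 \<gamma> t_nonzero by (simp add: look v_mult v_inverse mono_eval_nonzero v_mono_eval v_t)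
  have "inverse ?g * ?g' \<in> \<O>"
    using red unfolding reduces_def
    by (metis lookup_mp_const_mult lookup_shift_zero[OF cring_map_\<sigma>])
  then have le: "v ?g \<le> v ?g'" using \<gamma>(2) nz by (simp add: \<O>_iff v_mult v_inverse)
  obtain \<gamma>' where c': "critical_radius p a' \<gamma>'"
    using critical_radius_exists[OF nz e(2) A0] by blast
  then have "v ?g' \<le> v (?A e) + wt e * \<gamma>'" using e(2) A0 by (simp add: critical_radius_def)
  then have "v ?g' - v ?g \<le> wt e * (\<gamma>' - \<gamma>)" using eq by (simp add: algebra_simps)
  then show ?thesis
    using that[OF c'] le wt_pos[OF e(2)]
    by (smt (verit, best) mult_nonneg_nonpos mult_pos_neg zero_less_mult_iff)
qed

lemma critical_radius_unique:
  assumes "critical_radius p a \<gamma>" "critical_radius p a \<gamma>'" shows "\<gamma> = \<gamma>'"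
proof -
  have le: "\<gamma> \<le> \<gamma>'" if c: "critical_radius p a \<gamma>" "critical_radius p a \<gamma>'" for \<gamma> \<gamma>'
  proof -
    let ?A = "Poly_Mapping.lookup (shift \<sigma> a 1 p)"
    obtain e where e: "e \<noteq> 0" "?A e \<noteq> 0" "v (diff_eval \<sigma> p a) = v (?A e) + wt e * \<gamma>"
      using c(1) by (auto simp: critical_radius_def)
    then have "wt e * \<gamma> \<le> wt e * \<gamma>'" using c(2) by (auto simp: critical_radius_def)
    then show ?thesis using wt_pos[OF e(1)] by simp
  qed
  show ?thesis using le[OF assms] le[OF assms(2,1)] by simp
qed

lemma diff_eval_improve:
  assumes c: "critical_radius p a \<gamma>"
  obtains a' where "a' \<in> closed_vball v a \<gamma>"
    "diff_eval \<sigma> p a' = 0 \<or> v (diff_eval \<sigma> p a) < v (diff_eval \<sigma> p a')"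
proof -
  let ?g = "diff_eval \<sigma> p a"
  have \<gamma>: "\<gamma> \<in> \<Gamma>" "?g \<noteq> 0" using c by (auto simp: critical_radius_def)
  obtain q where q: "reduces (mp_const (inverse ?g) * shift \<sigma> a (t \<gamma>) p) q" "mp_vars q \<noteq> {}"
    using critical_radius_reduction[OF c] by blast
  obtain c where c: "diff_eval \<sigma>' q c = 0"
    using acfa_poly_root[OF acfa q(2)] by (auto simp: diff_eval_def)
  obtain x where x: "x \<in> \<O>" "res x = c" by (rule res_surj)
  let ?a = "a + t \<gamma> * x" let ?g' = "diff_eval \<sigma> p ?a"
  have "reduces (mp_const (inverse ?g) * shift \<sigma> ?a (t \<gamma>) p) (shift \<sigma>' c 1 q)"
    using reduces_shift[OF q(1) x(1)] x(2)
    by (simp add: shift_const_mult[OF cring_map_\<sigma>] shift_shift[OF cring_map_\<sigma>])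
  then have "inverse ?g * ?g' \<in> \<O>" "res (inverse ?g * ?g') = 0"
    using c unfolding reduces_def
    by (metis lookup_mp_const_mult lookup_shift_zero[OF cring_map_\<sigma>] lookup_shift_zero[OF cring_map_\<sigma>'])+
  then have "?g' = 0 \<or> v ?g < v ?g'"
    using \<gamma>(2) by (cases "?g' = 0") (auto simp: res_eq_0_iff v_mult v_inverse)
  moreover have "?a \<in> closed_vball v a \<gamma>" using closed_vball_iff[OF \<gamma>(1)] x(1) by blast
  ultimately show ?thesis using that by blast
qed

lemma closed_vball_mono:
  assumes "a' \<in> closed_vball v a \<gamma>" "\<gamma> \<le> \<gamma>'" "\<gamma> \<in> \<Gamma>" "\<gamma>' \<in> \<Gamma>"
  shows "closed_vball v a' \<gamma>' \<subseteq> closed_vball v a \<gamma>"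
proof
  fix z assume z: "z \<in> closed_vball v a' \<gamma>'"
  have "z = a \<or> \<gamma> \<le> v (z - a)"
    using v_add[of "z - a'" "a' - a"] assms(1,2) z
    by (cases "z = a' \<or> a' = a \<or> z = a") (auto simp: closed_vball_def min_le_iff_disj)
  then show "z \<in> closed_vball v a \<gamma>" by (simp add: closed_vball_def)
qed

theorem small_root_exists:
  assumes e: "e \<noteq> 0" "Poly_Mapping.lookup p e \<noteq> 0"
    and small: "Poly_Mapping.lookup p 0 = 0 \<or> v (Poly_Mapping.lookup p e) < v (Poly_Mapping.lookup p 0)"
  obtains s where "diff_eval \<sigma> p s = 0" "s = 0 \<or> 0 < v s"
proof (rule ccontr)
  note root = that
  assume no: "\<not> thesis"
  have p0: "Poly_Mapping.lookup p 0 = diff_eval \<sigma> p 0"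
    using lookup_shift_zero[OF cring_map_\<sigma>, of 0 1 p] by (simp add: shift_zero_one[OF cring_map_\<sigma>])
  have g0: "diff_eval \<sigma> p 0 \<noteq> 0" using no that by blast
  obtain \<gamma>0 where c0: "critical_radius p 0 \<gamma>0"
    using critical_radius_exists[OF g0 e(1)] e(2) by (auto simp: shift_zero_one[OF cring_map_\<sigma>])
  then have "v (Poly_Mapping.lookup p 0) \<le> v (Poly_Mapping.lookup p e) + wt e * \<gamma>0"
    using e by (auto simp: critical_radius_def shift_zero_one[OF cring_map_\<sigma>] p0)
  \<comment> \<open>The smallness of the constant term forces the first radius to be positive, so
    the whole search takes place in the maximal ideal.\<close>
  then have "0 < wt e * \<gamma>0" using small p0 g0 by auto
  then have \<gamma>0: "0 < \<gamma>0" using wt_pos[OF e(1)] by (simp add: zero_less_mult_iff)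
  let ?B0 = "closed_vball v 0 \<gamma>0"
  have nz: "diff_eval \<sigma> p a \<noteq> 0" if "a \<in> ?B0" for a
  proof
    assume "diff_eval \<sigma> p a = 0"
    moreover have "a = 0 \<or> 0 < v a" using that \<gamma>0 by (auto simp: closed_vball_def)
    ultimately have thesis by (rule root)
    then show False using no by simp
  qed
  define F where "F = {closed_vball v a \<gamma> |a \<gamma>. critical_radius p a \<gamma> \<and> closed_vball v a \<gamma> \<subseteq> ?B0}"
  have F0: "?B0 \<in> F" using c0 by (auto simp: F_def)
  \<comment> \<open>A maximal chain of critical balls replaces transfinite recursion: spherical
    completeness is the limit step, and \<open>maxM\<close> says that no further ball of
    \<open>F\<close> lies below the chain.\<close>
  obtain M where M: "subset.maxchain F M" using subset.Hausdorff[of F] by blast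
  have MF: "M \<subseteq> F" and chain: "\<And>A B. A \<in> M \<Longrightarrow> B \<in> M \<Longrightarrow> A \<subseteq> B \<or> B \<subseteq> A"
    using subset.maxchain_imp_chain[OF M] by (auto simp: subset_chain_def)
  have maxM: "B \<in> M" if "B \<in> F" "\<And>A. A \<in> M \<Longrightarrow> B \<subseteq> A" for B
  proof (rule ccontr)
    assume "B \<notin> M"
    moreover have "subset.chain F (insert B M)"
      using MF chain that by (auto simp: subset_chain_def)
    ultimately show False using M unfolding subset.maxchain_def by blast
  qed
  have "M \<noteq> {}" using maxM[OF F0] by blast
  moreover have "F \<subseteq> vballs v" unfolding F_def vballs_def critical_radius_def by blast
  then have "M \<subseteq> vballs v" using MF by blast
  ultimately have "\<Inter>M \<noteq> {}" using sph chain unfolding spherically_complete_def by blast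
  then obtain a' where a': "\<And>B. B \<in> M \<Longrightarrow> a' \<in> B" by blast
  obtain B where "B \<in> M" using \<open>M \<noteq> {}\<close> by blast
  then have "a' \<in> ?B0" using a' MF by (auto simp: F_def)
  then obtain \<gamma>' where c': "critical_radius p a' \<gamma>'" by (metis critical_radius_in_ball[OF c0] nz)
  have \<gamma>': "\<gamma>' \<in> \<Gamma>" using c' by (simp add: critical_radius_def)
  \<comment> \<open>Each ball of the chain yields some critical radius at \<open>a'\<close> at least
    as large as its own; uniqueness identifies all of them with \<open>\<gamma>'\<close>.\<close>
  have sub: "closed_vball v a' \<gamma>' \<subseteq> B" if B: "B \<in> M" for B
  proof -
    obtain a \<gamma> where a: "B = closed_vball v a \<gamma>" "critical_radius p a \<gamma>"
      using B MF by (auto simp: F_def)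
    have in_B: "a' \<in> closed_vball v a \<gamma>" using a'[OF B] a(1) by simp
    obtain \<gamma>1 where "critical_radius p a' \<gamma>1" "\<gamma> \<le> \<gamma>1"
      using critical_radius_in_ball[OF a(2) in_B nz[OF \<open>a' \<in> ?B0\<close>]] by blast
    then have "\<gamma> \<le> \<gamma>'" using critical_radius_unique[OF c'] by blast
    then show ?thesis
      unfolding a(1) using in_B \<gamma>' a(2) by (intro closed_vball_mono) (auto simp: critical_radius_def)
  qed
  have sub0: "closed_vball v a' \<gamma>' \<subseteq> ?B0" using sub[OF \<open>B \<in> M\<close>] \<open>B \<in> M\<close> MF by (auto simp: F_def)
  obtain a2 where a2: "a2 \<in> closed_vball v a' \<gamma>'"
    "diff_eval \<sigma> p a2 = 0 \<or> v (diff_eval \<sigma> p a') < v (diff_eval \<sigma> p a2)"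
    using diff_eval_improve[OF c'] by blast
  have nz2: "diff_eval \<sigma> p a2 \<noteq> 0" using nz a2(1) sub0 by blast
  obtain \<gamma>2 where c2: "critical_radius p a2 \<gamma>2" "\<gamma>' < \<gamma>2"
    using critical_radius_in_ball[OF c' a2(1) nz2] a2(2) nz2 by metis
  have sub2: "closed_vball v a2 \<gamma>2 \<subseteq> closed_vball v a' \<gamma>'"
    using a2(1) c2 \<gamma>' by (intro closed_vball_mono) (auto simp: critical_radius_def)
  \<comment> \<open>The improved ball would belong to the chain and hence contain the ball around
    \<open>a'\<close>. But \<open>a2 + t \<gamma>'\<close> lies in the latter, and its difference
    from \<open>a2\<close> has value \<open>\<gamma>'\<close>, less than
    \<open>\<gamma>2\<close>.\<close>
  have "closed_vball v a2 \<gamma>2 \<in> M"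
  proof (rule maxM)
    show "closed_vball v a2 \<gamma>2 \<in> F" using c2(1) sub2 sub0 unfolding F_def by blast
  qed (use sub sub2 in blast)
  then have "closed_vball v a' \<gamma>' \<subseteq> closed_vball v a2 \<gamma>2" by (rule sub)
  moreover have "a2 + t \<gamma>' \<in> closed_vball v a' \<gamma>'"
  proof -
    have "a2 + t \<gamma>' \<in> closed_vball v a2 \<gamma>'" using v_t[OF \<gamma>'] by (simp add: closed_vball_def)
    then show ?thesis using closed_vball_mono[OF a2(1) order_refl \<gamma>' \<gamma>'] by blast
  qed
  ultimately have "a2 + t \<gamma>' \<in> closed_vball v a2 \<gamma>2" by blast
  then show False using v_t[OF \<gamma>'] t_nonzero[OF \<gamma>'] c2(2) by (simp add: closed_vball_def)
qed

end

section \<open>Laurent difference polynomials\<close>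

text \<open>Multiplying \<open>x\<^bsup>u(\<sigma>)\<^esup>\<close> by the \<open>N\<close>-th powers of all variables of order at most \<open>D\<close> clears the
  negative exponents.\<close>

definition exponent :: "nat \<Rightarrow> nat \<Rightarrow> ('n::finite \<Rightarrow> int poly) \<Rightarrow> ('n \<times> nat) \<Rightarrow>\<^sub>0 nat" where
  "exponent D N u = (\<Sum>(i, j)\<in>UNIV \<times> {..D}. Poly_Mapping.single (i, j) (nat (coeff (u i) j + int N)))"

lemma lookup_exponent:
  "Poly_Mapping.lookup (exponent D N u) (i, j) = (if j \<le> D then nat (coeff (u i) j + int N) else 0)"
proof -
  have "Poly_Mapping.lookup (exponent D N u) (i, j)
      = (\<Sum>k\<in>UNIV \<times> {..D}. if k = (i, j) then nat (coeff (u i) j + int N) else 0)"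
    unfolding exponent_def lookup_sum
    by (rule sum.cong) (auto simp: lookup_single when_def split: if_splits)
  then show ?thesis by (simp add: sum.delta')
qed

lemma keys_exponent: "Poly_Mapping.keys (exponent D N u) \<subseteq> UNIV \<times> {..D}"
  by (auto simp: in_keys_iff lookup_exponent split: if_splits)

lemma monom_eval_superset:
  assumes "\<And>i. degree (u i) \<le> D"
  shows "monom_eval \<tau> u y = (\<Prod>i\<in>UNIV. \<Prod>j\<le>D. ((\<tau> ^^ j) (y i)) powi coeff (u i) j)"
  unfolding monom_eval_def
  by (intro prod.cong prod.mono_neutral_left) (use assms in \<open>auto simp: coeff_eq_0 intro: le_trans\<close>)

lemma mono_eval_exponent:
  fixes \<tau> :: "'l::field \<Rightarrow> 'l"
  assumes D: "\<And>i. degree (u i) \<le> D" and N: "\<And>i j. j \<le> D \<Longrightarrow> 0 \<le> coeff (u i) j + int N"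
    and y: "\<And>i j. (\<tau> ^^ j) (y i) \<noteq> 0"
  shows "mono_eval (\<lambda>(i, j). (\<tau> ^^ j) (y i)) (exponent D N u)
       = (\<Prod>i\<in>UNIV. \<Prod>j\<le>D. ((\<tau> ^^ j) (y i)) ^ N) * monom_eval \<tau> u y"
proof -
  have "mono_eval (\<lambda>(i, j). (\<tau> ^^ j) (y i)) (exponent D N u)
      = (\<Prod>(i, j)\<in>UNIV \<times> {..D}. ((\<tau> ^^ j) (y i)) ^ nat (coeff (u i) j + int N))"
    by (subst mono_eval_superset[OF _ keys_exponent]) (auto intro!: prod.cong simp: lookup_exponent)
  also have "\<dots> = (\<Prod>i\<in>UNIV. \<Prod>j\<le>D. ((\<tau> ^^ j) (y i)) ^ nat (coeff (u i) j + int N))"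
    by (simp add: prod.cartesian_product)
  also have "\<dots> = (\<Prod>i\<in>UNIV. \<Prod>j\<le>D. ((\<tau> ^^ j) (y i)) ^ N * ((\<tau> ^^ j) (y i)) powi coeff (u i) j)"
  proof (intro prod.cong refl)
    fix i j assume "j \<in> {..D}"
    then have "((\<tau> ^^ j) (y i)) ^ nat (coeff (u i) j + int N) = ((\<tau> ^^ j) (y i)) powi (coeff (u i) j + int N)"
      using N[of j i] by (simp add: power_int_def)
    then show "((\<tau> ^^ j) (y i)) ^ nat (coeff (u i) j + int N)
        = ((\<tau> ^^ j) (y i)) ^ N * ((\<tau> ^^ j) (y i)) powi coeff (u i) j"
      using y by (simp add: power_int_add mult.commute)
  qed
  finally show ?thesis by (simp add: prod.distrib monom_eval_superset[OF D])
qed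

lemma monom_eval_mult:
  assumes "cring_map \<tau>"
  shows "monom_eval \<tau> u (\<lambda>i. x i * y i) = monom_eval \<tau> u x * monom_eval \<tau> u y"
  using cring_map.hom_mult[OF cring_map_funpow[OF assms]]
  by (simp add: monom_eval_def power_int_mult_distrib prod.distrib)

context acfa_valued_field
begin

section \<open>The splitting and its monomials\<close>

lemma t_add: "\<gamma> \<in> \<Gamma> \<Longrightarrow> \<delta> \<in> \<Gamma> \<Longrightarrow> t (\<gamma> + \<delta>) = t \<gamma> * t \<delta>"
  using splitting by (simp add: compatible_splitting_def)

lemma \<Gamma>_zero: "0 \<in> \<Gamma>"
  using \<Gamma>_v[of 1] by simp

lemma t_zero: "t 0 = 1"
  using t_add[OF \<Gamma>_zero \<Gamma>_zero] t_nonzero[OF \<Gamma>_zero] by simp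

lemma t_minus: "\<gamma> \<in> \<Gamma> \<Longrightarrow> t (- \<gamma>) = inverse (t \<gamma>)"
  using t_add[of \<gamma> "- \<gamma>"] \<Gamma>_minus t_zero by (simp add: inverse_unique)

lemma \<Gamma>_sum: "(\<And>i. i \<in> A \<Longrightarrow> f i \<in> \<Gamma>) \<Longrightarrow> sum f A \<in> \<Gamma>"
  by (induction A rule: infinite_finite_induct) (auto intro: \<Gamma>_zero \<Gamma>_add)

lemma t_sum: "(\<And>i. i \<in> A \<Longrightarrow> f i \<in> \<Gamma>) \<Longrightarrow> t (sum f A) = (\<Prod>i\<in>A. t (f i))"
  by (induction A rule: infinite_finite_induct) (auto simp: t_zero t_add \<Gamma>_sum)

lemma t_nat: "\<gamma> \<in> \<Gamma> \<Longrightarrow> real n * \<gamma> \<in> \<Gamma> \<and> t (real n * \<gamma>) = t \<gamma> ^ n"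
  by (induction n) (auto simp: \<Gamma>_zero t_zero algebra_simps \<Gamma>_add t_add)

lemma t_int: "\<gamma> \<in> \<Gamma> \<Longrightarrow> real_of_int k * \<gamma> \<in> \<Gamma> \<and> t (real_of_int k * \<gamma>) = t \<gamma> powi k"
proof (cases "0 \<le> k")
  case True
  then show "\<gamma> \<in> \<Gamma> \<Longrightarrow> ?thesis" using t_nat[of \<gamma> "nat k"] by (simp add: power_int_def)
next
  case False
  then have "real_of_int k * \<gamma> = - (real (nat (- k)) * \<gamma>)" by simp
  then show "\<gamma> \<in> \<Gamma> \<Longrightarrow> ?thesis"
    using False t_nat[of \<gamma> "nat (- k)"] \<Gamma>_minus[of "real (nat (- k)) * \<gamma>"]
      t_minus[of "real (nat (- k)) * \<gamma>"]
    by (simp add: power_int_def power_inverse)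
qed

lemma \<sigma>n_t: "\<gamma> \<in> \<Gamma> \<Longrightarrow> \<rho> ^ n * \<gamma> \<in> \<Gamma> \<and> (\<sigma> ^^ n) (t \<gamma>) = t (\<rho> ^ n * \<gamma>)"
proof (induction n)
  case (Suc n)
  then have *: "\<rho> ^ n * \<gamma> \<in> \<Gamma>" "(\<sigma> ^^ n) (t \<gamma>) = t (\<rho> ^ n * \<gamma>)" by auto
  have "v ((\<sigma> ^^ Suc n) (t \<gamma>)) \<in> \<Gamma>" by (intro \<Gamma>_v) (use t_nonzero Suc.prems in \<open>simp del: funpow.simps\<close>)
  then have "\<rho> ^ Suc n * \<gamma> \<in> \<Gamma>" using v_\<sigma>n[OF t_nonzero, of \<gamma> "Suc n"] Suc.prems by (simp add: v_t)
  moreover have "\<sigma> (t (\<rho> ^ n * \<gamma>)) = t (\<rho> * (\<rho> ^ n * \<gamma>))"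
    using splitting *(1) by (simp add: compatible_splitting_def)
  ultimately show ?case using * by (simp add: mult.assoc)
qed simp

definition monom_weight :: "('n::finite \<Rightarrow> real) \<Rightarrow> ('n \<Rightarrow> int poly) \<Rightarrow> real" where
  "monom_weight w u = (\<Sum>i\<in>UNIV. poly (map_poly of_int (u i)) \<rho> * w i)"

text \<open>Compatibility turns \<sigma>^j into multiplication of exponents by \<rho>^j, so a
  monomial at t^w is exactly a value of the splitting, with no unit factor left over.\<close>

lemma monom_eval_t:
  assumes "\<And>i. w i \<in> \<Gamma>"
  shows "monom_weight w u \<in> \<Gamma> \<and> monom_eval \<sigma> u (\<lambda>i. t (w i)) = t (monom_weight w u)"
proof -
  have W: "monom_weight w u = (\<Sum>i\<in>UNIV. \<Sum>j\<le>degree (u i). real_of_int (coeff (u i) j) * (\<rho> ^ j * w i))"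
    unfolding monom_weight_def
    by (simp add: poly_altdef degree_map_poly coeff_map_poly sum_distrib_right mult.assoc)
  have "real_of_int (coeff (u i) j) * (\<rho> ^ j * w i) \<in> \<Gamma>"
    "t (real_of_int (coeff (u i) j) * (\<rho> ^ j * w i)) = ((\<sigma> ^^ j) (t (w i))) powi coeff (u i) j" for i j
    using t_int[of "\<rho> ^ j * w i" "coeff (u i) j"] \<sigma>n_t[OF assms, of j i] by auto
  then show ?thesis
    by (simp add: W monom_eval_def t_sum \<Gamma>_sum)
qed

text \<open>Substituting \<open>y\<^sub>i = t\<^bsup>w\<^sub>i\<^esup> (a\<^sub>i + \<sigma>\<^bsup>B k\<^sub>i\<^esup> s)\<close>, with the \<open>k\<^sub>i\<close> distinct and \<open>B\<close> larger than
  the order of \<open>f\<close>, reduces to one unknown \<open>s\<close>: the variables \<open>\<sigma>\<^bsup>j + B k\<^sub>i\<^esup> s\<close> that occur are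
  distinct, so the reduction of the resulting difference polynomial remains nonzero.\<close>

theorem laurent_root_lifting:
  fixes f :: "('n::finite, 'a) laurent_difference_poly"
  assumes "f \<noteq> 0" and w: "\<And>i. w i \<in> \<Gamma>" and \<alpha>: "\<And>i. \<alpha> i \<noteq> 0"
    and root: "laurent_eval \<sigma>' (initial_form v \<rho> res t w f) \<alpha> = 0"
  shows "\<exists>y. (\<forall>i. y i \<noteq> 0) \<and> laurent_eval \<sigma> f y = 0 \<and> (\<forall>i. v (y i) = w i) \<and>
           (\<forall>i. res (t (- w i) * y i) = \<alpha> i)"
proof -
  let ?c = "Poly_Mapping.lookup f" and ?W = "monom_weight w" and ?K = "Poly_Mapping.keys f"
  define m where "m = trop v \<rho> f w"
  have tw: "term_weight v \<rho> w f u = v (?c u) + ?W u" for u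
    by (simp add: term_weight_def monom_weight_def)
  have W\<Gamma>: "?W u \<in> \<Gamma>" and mt: "monom_eval \<sigma> u (\<lambda>i. t (w i)) = t (?W u)" for u
    using monom_eval_t[of w u] w by auto
  have Kne: "?K \<noteq> {}" using \<open>f \<noteq> 0\<close> by (metis poly_mapping_eqI lookup_zero empty_iff in_keys_iff)
  have "m \<in> term_weight v \<rho> w f ` ?K" unfolding m_def trop_def by (rule Min_in) (use Kne in auto)
  then obtain u0 where u0: "u0 \<in> ?K" "m = v (?c u0) + ?W u0" by (auto simp: tw)
  have m\<Gamma>: "m \<in> \<Gamma>" using u0 W\<Gamma> by (auto simp: in_keys_iff intro!: \<Gamma>_add \<Gamma>_v)
  have m_le: "m \<le> v (?c u) + ?W u" if "u \<in> ?K" for u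
    unfolding m_def trop_def tw[symmetric] by (rule Min_le) (use that in auto)
  \<comment> \<open>The coefficients after substituting t^w z and dividing by t^m: all integral, and
    units exactly at the exponents of the initial form.\<close>
  define c' where "c' u = ?c u * t (?W u - m)" for u
  have Wm: "?W u - m \<in> \<Gamma>" for u using W\<Gamma> m\<Gamma> by (rule \<Gamma>_diff)
  have c'0: "c' u \<noteq> 0" and vc': "v (c' u) = v (?c u) + ?W u - m" if "u \<in> ?K" for u
    using that t_nonzero[OF Wm] v_t[OF Wm] by (auto simp: c'_def v_mult in_keys_iff)
  have c'O: "c' u \<in> \<O>" if "u \<in> ?K" for u using vc'[OF that] m_le[OF that] by (simp add: \<O>_iff)
  define S where "S = {u \<in> ?K. term_weight v \<rho> w f u = m}"
  have res_c': "res (c' u) \<noteq> 0 \<longleftrightarrow> u \<in> S" if "u \<in> ?K" for u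
    using res_eq_0_iff[OF c'O[OF that]] c'0[OF that] vc'[OF that] m_le[OF that] that
    by (auto simp: S_def tw)
  \<comment> \<open>On \<open>S\<close> the weight satisfies \<open>?W u - m = - v (?c u)\<close>,
    so the normalisation agrees with that in the initial form.\<close>
  have res_S: "res (?c u * t (- v (?c u))) = res (c' u)" if "u \<in> S" for u
  proof -
    have "?W u - m = - v (?c u)" using that by (auto simp: S_def tw)
    then show ?thesis by (simp add: c'_def)
  qed
  have init: "Poly_Mapping.lookup (initial_form v \<rho> res t w f) u = (if u \<in> S then res (c' u) else 0)" for u
  proof -
    have "Poly_Mapping.lookup (initial_form v \<rho> res t w f) u = (\<Sum>u'\<in>S. if u' = u then res (c' u) else 0)"
      unfolding initial_form_def m_def[symmetric] S_def[symmetric] lookup_sum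
      by (rule sum.cong) (auto simp: lookup_single when_def res_S)
    then show ?thesis by (simp add: S_def)
  qed
  have keys_init: "Poly_Mapping.keys (initial_form v \<rho> res t w f) = S"
    using res_c' by (auto simp: in_keys_iff init S_def split: if_splits)
  have root': "(\<Sum>u\<in>?K. res (c' u) * monom_eval \<sigma>' u \<alpha>) = 0"
  proof -
    have "(\<Sum>u\<in>?K. res (c' u) * monom_eval \<sigma>' u \<alpha>) = (\<Sum>u\<in>S. res (c' u) * monom_eval \<sigma>' u \<alpha>)"
      by (rule sum.mono_neutral_right) (use res_c' in \<open>auto simp: S_def\<close>)
    then show ?thesis using root by (simp add: laurent_eval_def keys_init init)
  qed
  have eval_f: "laurent_eval \<sigma> f (\<lambda>i. t (w i) * z i) = t m * (\<Sum>u\<in>?K. c' u * monom_eval \<sigma> u z)" for z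
  proof -
    have "t (?W u) = t m * t (?W u - m)" for u using t_add[OF m\<Gamma> Wm, of u] by simp
    then show ?thesis
      by (simp add: laurent_eval_def monom_eval_mult[OF cring_map_\<sigma>] mt c'_def sum_distrib_left mult_ac)
  qed

  define D where "D = Max ((\<lambda>(u, i). degree (u i)) ` (?K \<times> UNIV))"
  have D: "degree (u i) \<le> D" if "u \<in> ?K" for u i
    unfolding D_def by (rule Max_ge) (use that in \<open>auto intro!: image_eqI[of _ _ "(u, i)"]\<close>)
  \<comment> \<open>Any uniform bound on the negative exponents would do; the sum of all absolute
    values is one.\<close>
  define N where "N = nat (\<Sum>u\<in>?K. \<Sum>i\<in>UNIV. \<Sum>j\<le>D. \<bar>coeff (u i) j\<bar>)"
  have N: "0 \<le> coeff (u i) j + int N" if "u \<in> ?K" "j \<le> D" for u i j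
  proof -
    have "\<bar>coeff (u i) j\<bar> \<le> (\<Sum>j\<le>D. \<bar>coeff (u i) j\<bar>)" by (rule member_le_sum) (use that in auto)
    also have "\<dots> \<le> (\<Sum>i\<in>UNIV. \<Sum>j\<le>D. \<bar>coeff (u i) j\<bar>)" by (rule member_le_sum) (auto intro: sum_nonneg)
    also have "\<dots> \<le> (\<Sum>u\<in>?K. \<Sum>i\<in>UNIV. \<Sum>j\<le>D. \<bar>coeff (u i) j\<bar>)"
      by (rule member_le_sum) (use that in \<open>auto intro: sum_nonneg\<close>)
    finally show ?thesis unfolding N_def by linarith
  qed
  let ?e = "exponent D N"
  have inj: "inj_on ?e ?K"
  proof (intro inj_onI ext poly_eqI)
    fix u u' i j assume K: "u \<in> ?K" "u' \<in> ?K" and eq: "?e u = ?e u'"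
    show "coeff (u i) j = coeff (u' i) j"
    proof (cases "j \<le> D")
      case True
      then have "nat (coeff (u i) j + int N) = nat (coeff (u' i) j + int N)"
        using arg_cong[OF eq, of "\<lambda>e. Poly_Mapping.lookup e (i, j)"] by (simp add: lookup_exponent)
      then show ?thesis using N K True by (simp add: eq_nat_nat_iff)
    next
      case False
      then show ?thesis using D[OF K(1), of i] D[OF K(2), of i] by (simp add: coeff_eq_0)
    qed
  qed
  define P where "P = (\<Sum>u\<in>?K. Poly_Mapping.single (?e u) (c' u))"
  define P' where "P' = (\<Sum>u\<in>?K. Poly_Mapping.single (?e u) (res (c' u)))"
  have red: "reduces P P'" unfolding P_def P'_def by (intro reduces_sum reduces_single c'O refl)
  have "Poly_Mapping.lookup P' (?e u0) = (\<Sum>u\<in>?K. if u = u0 then res (c' u0) else 0)"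
    unfolding P'_def lookup_sum
    by (rule sum.cong) (use inj u0(1) in \<open>auto simp: lookup_single when_def inj_on_def\<close>)
  then have "Poly_Mapping.lookup P' (?e u0) \<noteq> 0" using u0 res_c' by (simp add: S_def tw)
  then have P'0: "P' \<noteq> 0" by auto
  have ev: "mp_eval (\<lambda>c. c) x (\<Sum>u\<in>?K. Poly_Mapping.single (?e u) (b u)) = (\<Sum>u\<in>?K. b u * mono_eval x (?e u))"
    for x and b :: "_ \<Rightarrow> 'l::field"
    by (simp add: cring_map.hom_sum[OF cring_map.mp_eval_hom[OF cring_map_id]] mp_eval_single)
  have evalP: "mp_eval (\<lambda>c. c) (\<lambda>(i, j). (\<sigma> ^^ j) (z i)) P
      = (\<Prod>i\<in>UNIV. \<Prod>j\<le>D. ((\<sigma> ^^ j) (z i)) ^ N) * (\<Sum>u\<in>?K. c' u * monom_eval \<sigma> u z)"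
    if "\<And>i. z i \<noteq> 0" for z
    unfolding P_def ev sum_distrib_left
    by (rule sum.cong) (use that in \<open>simp_all add: mono_eval_exponent D N mult_ac\<close>)
  have \<sigma>'n: "(\<sigma>' ^^ j) c \<noteq> 0" if "c \<noteq> 0" for j c
    using that cring_map_field_inj[OF cring_map_funpow[OF cring_map_\<sigma>']]
      cring_map.hom_zero[OF cring_map_funpow[OF cring_map_\<sigma>']] by (metis injD)
  have evalP': "mp_eval (\<lambda>c. c) (\<lambda>(i, j). (\<sigma>' ^^ j) (\<alpha> i)) P' = 0"
  proof -
    have "mp_eval (\<lambda>c. c) (\<lambda>(i, j). (\<sigma>' ^^ j) (\<alpha> i)) P'
      = (\<Prod>i\<in>UNIV. \<Prod>j\<le>D. ((\<sigma>' ^^ j) (\<alpha> i)) ^ N) * (\<Sum>u\<in>?K. res (c' u) * monom_eval \<sigma>' u \<alpha>)"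
      unfolding P'_def ev sum_distrib_left
      by (rule sum.cong) (use \<alpha> \<sigma>'n in \<open>simp_all add: mono_eval_exponent D N mult_ac\<close>)
    then show ?thesis using root' by simp
  qed
  have "\<exists>a. \<forall>i. a i \<in> \<O> \<and> res (a i) = \<alpha> i" by (intro choice allI) (metis res_surj)
  then obtain a where a: "\<And>i. a i \<in> \<O>" "\<And>i. res (a i) = \<alpha> i" by blast
  obtain idx :: "'n \<Rightarrow> nat" where idx: "inj idx"
    using finite_imp_inj_to_nat_seg[OF finite_UNIV] by blast
  \<comment> \<open>The block length exceeds every order \<open>j\<close> that occurs, so
    \<open>j + B * idx i\<close> determines \<open>j\<close> by \<open>mod\<close> and
    \<open>i\<close> by \<open>div\<close>.\<close>
  define B where "B = Suc D"
  define x where "x = (\<lambda>(i, j). mp_const ((\<sigma> ^^ j) (a i)) + mp_var (j + B * idx i) :: (nat, 'a) mpol)"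
  define x' where "x' = (\<lambda>(i, j). mp_const ((\<sigma>' ^^ j) (\<alpha> i)) + mp_var (j + B * idx i) :: (nat, 'k) mpol)"
  define p where "p = mp_eval mp_const x P"
  define p' where "p' = mp_eval mp_const x' P'"
  have redp: "reduces p p'"
    unfolding p_def p'_def
  proof (rule reduces_mp_eval[OF red])
    fix k :: "'n \<times> nat"
    obtain i j where k: "k = (i, j)" by (cases k)
    show "reduces (x k) (x' k)"
      using reduces_add[OF reduces_const[OF \<O>_\<sigma>n[OF a(1)]] reduces_var, of j i] a
      by (simp add: k x_def x'_def res_\<sigma>n)
  qed
  note Ck = cring_map_mp_const
  have p'0: "Poly_Mapping.lookup p' 0 = 0"
  proof -
    have "Poly_Mapping.lookup p' 0 = mp_eval (\<lambda>c. c) (\<lambda>k. mp_eval (\<lambda>c. c) (\<lambda>_. 0) (x' k)) P'"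
      unfolding lookup_zero_eq_mp_eval p'_def
      by (simp add: cring_map.hom_mp_eval[OF cring_map.mp_eval_hom[OF cring_map_id]]
          cring_map.mp_eval_const[OF cring_map_id])
    also have "(\<lambda>k. mp_eval (\<lambda>c. c) (\<lambda>_. 0) (x' k)) = (\<lambda>(i, j). (\<sigma>' ^^ j) (\<alpha> i))"
      by (auto simp: x'_def cring_map.mp_eval_add[OF cring_map_id]
          cring_map.mp_eval_const[OF cring_map_id] cring_map.mp_eval_var[OF cring_map_id])
    finally show ?thesis using evalP' by simp
  qed
  have "p' \<noteq> 0"
  proof
    assume z: "p' = 0"
    \<comment> \<open>Undoes the translation by lifts and the renumbering, so that \<open>P'\<close>
      can be recovered from \<open>p'\<close>. Indices whose block belongs to no variable receive
      irrelevant values.\<close>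
    define inverse_subst where "inverse_subst k = (mp_var (inv_into UNIV idx (k div B), k mod B)
        - mp_const ((\<sigma>' ^^ (k mod B)) (\<alpha> (inv_into UNIV idx (k div B)))) :: ('n \<times> nat, 'k) mpol)" for k
    have "mp_eval mp_const inverse_subst p' = mp_eval mp_const (\<lambda>k. mp_eval mp_const inverse_subst (x' k)) P'"
      unfolding p'_def
      by (simp add: cring_map.hom_mp_eval[OF cring_map.mp_eval_hom[OF Ck]] cring_map.mp_eval_const[OF Ck])
    also have "\<dots> = mp_eval mp_const mp_var P'"
    proof (rule mp_eval_cong)
      fix k assume k: "k \<in> mp_vars P'"
      obtain i j where ij: "k = (i, j)" by (cases k)
      obtain e where e: "e \<in> Poly_Mapping.keys P'" "k \<in> Poly_Mapping.keys e"
        using k by (auto simp: mp_vars_def)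
      then obtain u where "e = ?e u"
        using keys_sum[of "\<lambda>u. Poly_Mapping.single (?e u) (res (c' u))" ?K]
        by (auto simp: P'_def split: if_splits)
      then have "j < B" using e(2) keys_exponent ij by (fastforce simp: B_def)
      then have "(j + B * idx i) div B = idx i" "(j + B * idx i) mod B = j" by auto
      then show "mp_eval mp_const inverse_subst (x' k) = mp_var k"
        using idx by (simp add: ij x'_def cring_map.mp_eval_add[OF Ck] cring_map.mp_eval_const[OF Ck]
            cring_map.mp_eval_var[OF Ck] inverse_subst_def)
    qed
    finally have "mp_eval mp_const inverse_subst p' = P'" by (simp add: mp_eval_self)
    then show False using z P'0 by (simp add: mp_eval_def)
  qed
  \<comment> \<open>Since \<open>p'\<close> is nonzero with constant term 0, some nonconstant
    coefficient survives; it lifts to a unit coefficient of \<open>p\<close>.\<close>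
  then obtain e where e: "Poly_Mapping.lookup p' e \<noteq> 0" by (metis poly_mapping_eqI lookup_zero)
  then have e0: "e \<noteq> 0" using p'0 by auto
  have pe: "Poly_Mapping.lookup p e \<in> \<O>" "res (Poly_Mapping.lookup p e) \<noteq> 0"
    using redp e by (auto simp: reduces_def)
  then have pe0: "Poly_Mapping.lookup p e \<noteq> 0" by auto
  have "v (Poly_Mapping.lookup p e) = 0"
    using res_eq_0_iff[OF pe(1)] pe pe0 by (auto simp: \<O>_iff)
  moreover have "Poly_Mapping.lookup p 0 = 0 \<or> 0 < v (Poly_Mapping.lookup p 0)"
    using redp p'0 res_eq_0_iff[of "Poly_Mapping.lookup p 0"] by (auto simp: reduces_def)
  ultimately obtain s where s: "diff_eval \<sigma> p s = 0" "s = 0 \<or> 0 < v s"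
    using small_root_exists[OF e0 pe0] by auto
  define z where "z i = a i + (\<sigma> ^^ (B * idx i)) s" for i
  have s_small: "(\<sigma> ^^ n) s \<in> \<O> \<and> res ((\<sigma> ^^ n) s) = 0" for n
  proof (cases "s = 0")
    case False
    then have "0 < v ((\<sigma> ^^ n) s)" using s(2) \<rho>_pos by (simp add: v_\<sigma>n)
    moreover from this have "(\<sigma> ^^ n) s \<in> \<O>" by (simp add: \<O>_iff)
    ultimately show ?thesis by (simp add: res_eq_0_iff)
  qed (simp add: \<O>_closed)
  have zO: "z i \<in> \<O>" and res_z: "res (z i) = \<alpha> i" for i
    using a s_small by (auto simp: z_def \<O>_closed res_simps)
  have z0: "z i \<noteq> 0" for i using res_z[of i] \<alpha>[of i] by auto
  have vz: "v (z i) = 0" for i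
    using res_eq_0_iff[OF zO[of i]] zO[of i] z0[of i] res_z[of i] \<alpha>[of i] by (auto simp: \<O>_iff)
  have "diff_eval \<sigma> p s = mp_eval (\<lambda>c. c) (\<lambda>(i, j). (\<sigma> ^^ j) (z i)) P"
  proof -
    have "diff_eval \<sigma> p s = mp_eval (\<lambda>c. c) (\<lambda>k. diff_eval \<sigma> (x k) s) P"
      unfolding diff_eval_def p_def
      by (simp add: cring_map.hom_mp_eval[OF cring_map.mp_eval_hom[OF cring_map_id]]
          cring_map.mp_eval_const[OF cring_map_id])
    also have "(\<lambda>k. diff_eval \<sigma> (x k) s) = (\<lambda>(i, j). (\<sigma> ^^ j) (z i))"
      by (auto simp: x_def z_def diff_eval_def cring_map.mp_eval_add[OF cring_map_id] funpow_add
          cring_map.mp_eval_const[OF cring_map_id] cring_map.mp_eval_var[OF cring_map_id])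
    finally show ?thesis .
  qed
  \<comment> \<open>The factor that cleared the negative exponents is a product of powers of
    iterates of the nonzero \<open>z i\<close>, so it can be cancelled.\<close>
  then have "(\<Sum>u\<in>?K. c' u * monom_eval \<sigma> u z) = 0"
    using s(1) evalP[OF z0] z0 by simp
  then have "laurent_eval \<sigma> f (\<lambda>i. t (w i) * z i) = 0" by (simp add: eval_f)
  moreover have "t (- w i) * (t (w i) * z i) = z i" for i
    using t_nonzero[OF w] by (simp add: t_minus[OF w])
  ultimately show ?thesis
    using t_nonzero[OF w] z0 vz v_t[OF w] res_z
    by (intro exI[of _ "\<lambda>i. t (w i) * z i"]) (auto simp: v_mult simp flip: mult.assoc)
qed

end

theorem proposition1p6:
  fixes v :: "'a::field_char_0 \<Rightarrow> real"
    and \<sigma> :: "'a \<Rightarrow> 'a"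
    and \<rho> :: real
    and res :: "'a \<Rightarrow> 'k::field_char_0"
    and \<sigma>' :: "'k \<Rightarrow> 'k"
    and t :: "real \<Rightarrow> 'a"
    and f :: "('n::finite, 'a) laurent_difference_poly"
    and w :: "'n \<Rightarrow> real"
    and \<alpha> :: "'n \<Rightarrow> 'k"
  assumes "valued_difference_field v \<sigma>"
    and "multiplicative_with_exponent v \<sigma> \<rho>"
    and "spherically_complete v"
    and "residue_map v res"
    and "induced_on_residues v res \<sigma> \<sigma>'"
    and "acfa \<sigma>'"
    and "\<not> algebraic \<rho>"
    and "\<forall>q\<in>rat_adjoin \<rho>. \<forall>\<gamma>\<in>value_group v. q * \<gamma> \<in> value_group v"
    and "compatible_splitting v \<sigma> \<rho> t"
    and "f \<noteq> 0"
    and "\<forall>i. w i \<in> value_group v"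
    and "\<not> is_monomial (initial_form v \<rho> res t w f)"
    and "\<forall>i. \<alpha> i \<noteq> 0"
    and "laurent_eval \<sigma>' (initial_form v \<rho> res t w f) \<alpha> = 0"
  shows "\<exists>y :: 'n \<Rightarrow> 'a.
           (\<forall>i. y i \<noteq> 0) \<and>
           laurent_eval \<sigma> f y = 0 \<and>
           (\<forall>i. v (y i) = w i) \<and>
           (\<forall>i. res (t (- w i) * y i) = \<alpha> i)"
proof -
  interpret acfa_valued_field v \<sigma> \<rho> res \<sigma>' t
    by unfold_locales (fact assms)+
  show ?thesis using laurent_root_lifting assms by blast
qed

end
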